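(* The set of Gödel codes of well-formed RGA terms $c$ that are grounded true, i.e. such that $c\Downarrow_s\mathsf{tt}$ for some $s\in\mathbb N$, is recursively enumerable.
   Context: **Terms.** Raw terms are: variables $v_i$ ($i\in\mathbb N$, de Bruijn indices), and operator nodes, each consisting of an operator code, a binder count $k\in\mathbb N$ and a finite list of raw terms as arguments, in each of which the $k$ lowest indices are bound. RGA has ten operators: constants $\bot$, $\mathbf 0$, $\mathcal R$ (recursor), $\mathcal A$ (universal quantifier combinator); unary $\mathbf S$, $\neg$; unary $\lambda$ (binder count 1, the only binder); binary $=$, $\lor$, and application $\cdot$ (left associative). A term $t$ is well-formed, $\mathrm{wf}(t)$, iff it is built from variables and these ten operators at these arities and binder counts. "Term" means raw term; formulas are just terms. Closed means having no free variables. $\underline n=\mathbf S^n\mathbf 0$ is the numeral of $n$. $[v_i\mapsto s]t$ (also $[i\mapsto s]t$): capture-avoiding replacement of the free variable $v_i$ by $s$, other free variables unchanged. $b[t]$: $\beta$-instance, replacing index $0$ in $b$ by $t$ and decrementing all other free indices. $\uparrow t$: all free indices increased by one; $\uparrow\Gamma$ elementwise. $\mathrm{fv}$: set of free variables. Abbreviations: $t\neq u:=\neg(t=u)$; $t\,\mathsf N:=(t=t)$; $t\,\mathsf B:=(t\lor\neg t)$; $t\land u:=\neg(\neg t\lor\neg u)$. **Head steps** $t\triangleright t'$ (syntactic relation): $(\lambda b)\cdot t\triangleright b[t]$ if $\mathrm{wf}(t)$; $\mathcal R\cdot g\cdot h\cdot\mathbf 0\triangleright g$ if $\mathrm{wf}(h)$;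 $\mathcal R\cdot g\cdot h\cdot(\mathbf S\,\underline n)\triangleright h\cdot\underline n\cdot(\mathcal R\cdot g\cdot h\cdot\underline n)$ if $\mathrm{wf}(g)$; and $t\cdot u\triangleright t'\cdot u$ if $t\triangleright t'$. **Proofs.** A judgment $\Gamma\vdash c$ has a finite set $\Gamma$ of terms and a term $c$. A proof is a finite list of judgments each following from earlier entries by one rule below; $P\rhd(\Gamma\vdash c)$ means $P$ is a valid proof containing $\Gamma\vdash c$; a judgment is derivable if some proof contains it. Writing $\Gamma\vdash c$ as an assertion means derivability. Rules ($\Rightarrow$ from premises to conclusion, $\Leftrightarrow$ both directions): Structural: $\mathrm{wf}(c)\Rightarrow\Gamma,c\vdash c$; $\Gamma\vdash c\Rightarrow\Gamma,a\vdash c$; $\Gamma\vdash a$ and $\Gamma,a\vdash c\Rightarrow\Gamma\vdash c$; $\Gamma\vdash c$ with $\Gamma,c,s$ well-formed $\Rightarrow[v\mapsto s]\Gamma\vdash[v\mapsto s]c$. Truth values: $\Gamma\vdash a\Leftrightarrow\Gamma\vdash a=\underline 1$; $\Gamma\vdash\neg a\Leftrightarrow\Gamma\vdash a=\underline 0$. Negation: $\Gamma\vdash\neg a$, $\Gamma\vdash a$, $\mathrm{wf}(c)\Rightarrow\Gamma\vdash c$; $\Gamma\vdash a\Leftrightarrow\Gamma\vdash\neg\neg a$. Disjunction: $\Gamma\vdash a$, $\mathrm{wf}(b)\Rightarrow\Gamma\vdash a\lor b$; $\Gamma\vdash b$, $\mathrm{wf}(a)\Rightarrow\Gamma\vdash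 a\lor b$; $\Gamma\vdash\neg a$, $\Gamma\vdash\neg b\Rightarrow\Gamma\vdash\neg(a\lor b)$; $\Gamma\vdash a\lor b$, $\Gamma,a\vdash c$, $\Gamma,b\vdash c\Rightarrow\Gamma\vdash c$; $\Gamma\vdash\neg(a\lor b)\Rightarrow\Gamma\vdash\neg a$, and $\Rightarrow\Gamma\vdash\neg b$. Equality: $\Gamma\vdash a\,\mathsf N\Leftrightarrow\Gamma\vdash a=a$; $\Gamma\vdash a=b\Rightarrow\Gamma\vdash b=a$; $\Gamma\vdash a=b$, $\Gamma\vdash[v\mapsto a]p$, $\mathrm{wf}(p)\Rightarrow\Gamma\vdash[v\mapsto b]p$; $\Gamma\vdash a\ne b\Rightarrow\Gamma\vdash b\ne a$; $\Gamma\vdash a\,\mathsf N$, $\Gamma\vdash b\,\mathsf N\Rightarrow\Gamma\vdash(a=b)\,\mathsf B$; $\Gamma\vdash(a=b)\,\mathsf B\Rightarrow\Gamma\vdash(a\,\mathsf N)\land(b\,\mathsf N)$. Naturals: $\Gamma\vdash\mathbf 0\,\mathsf N$; $\Gamma\vdash a\,\mathsf N\Leftrightarrow\Gamma\vdash\mathbf S a\,\mathsf N$; $\Gamma\vdash a\,\mathsf N\Rightarrow\Gamma\vdash\mathbf S a\ne\mathbf 0$; $\Gamma\vdash a\ne b\Leftrightarrow\Gamma\vdash\mathbf S a\ne\mathbf S b$; $\Gamma\vdash\mathbf S a=\mathbf S b\Rightarrow\Gamma\vdash a=b$; $\Gamma\vdash\bot\,\mathsf N$, $\mathrm{wf}(p)\Rightarrow\Gamma\vdash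 p$. Induction: $\Gamma\vdash[i\mapsto\mathbf 0]c$; $v_i\,\mathsf N,c,\Gamma\vdash[i\mapsto\mathbf S v_i]c$; $\Gamma\vdash a\,\mathsf N$; $\mathrm{wf}(c)$; $i\notin\mathrm{fv}(\Gamma)$ $\Rightarrow\Gamma\vdash[i\mapsto a]c$. Conversion: if $c\triangleright c'$: $\Gamma\vdash c'\Leftrightarrow\Gamma\vdash c$; $\Gamma\vdash c'\,\mathsf N\Rightarrow\Gamma\vdash c=c'$. Recursor: $\Gamma\vdash m\,\mathsf N$, $\Gamma\vdash(h\cdot m\cdot(\mathcal R\cdot g\cdot h\cdot m))\,\mathsf N$, $\mathrm{wf}(g)\Rightarrow\Gamma\vdash\mathcal R\cdot g\cdot h\cdot(\mathbf S m)=h\cdot m\cdot(\mathcal R\cdot g\cdot h\cdot m)$. Quantifier: $v_0\,\mathsf N,\uparrow\Gamma\vdash\uparrow f\cdot v_0\Rightarrow\Gamma\vdash\mathcal A\cdot f$; $\Gamma\vdash\mathcal A\cdot f$, $\Gamma\vdash a\,\mathsf N\Rightarrow\Gamma\vdash f\cdot a$; $\Gamma\vdash\neg(f\cdot a)$, $\Gamma\vdash a\,\mathsf N\Rightarrow\Gamma\vdash\neg(\mathcal A\cdot f)$; $\Gamma\vdash\neg(\mathcal A\cdot f)$ and $v_0\,\mathsf N,\neg(\uparrow f\cdot v_0),\uparrow\Gamma\vdash\uparrow c\Rightarrow\Gamma\vdash c$. **Evaluation.** Fix standard effective injective Gödel codings of terms, judgments and proofs by natural numbers, $\ulcorner P\urcorner$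 being the code of the proof $P$. Let $\mathsf{tt}=1$, $\mathsf{ff}=0$. Head shapes $w$ are: $\lambda b$; $\mathcal R$; $\mathcal R\,g$; $\mathcal R\,g\,h$; $\mathcal A$. Value evaluation $t\Downarrow_s r$ ($r,s\in\mathbb N$) and head evaluation $t\Downarrow^{\mathrm{hd}}_s w$ are the least relations on (possibly open) terms such that for all $s$ (there are no clauses for $\bot$ or variables): Values: $\mathbf 0\Downarrow_{s+1}0$; $a\Downarrow_s n\Rightarrow\mathbf S a\Downarrow_{s+1}n+1$; $a\Downarrow_s m$, $b\Downarrow_s n\Rightarrow(a=b)\Downarrow_{s+1}\mathsf{tt}$ if $m=n$ and $\mathsf{ff}$ otherwise; $a\Downarrow_s\mathsf{ff}\Rightarrow\neg a\Downarrow_{s+1}\mathsf{tt}$; $a\Downarrow_s\mathsf{tt}\Rightarrow\neg a\Downarrow_{s+1}\mathsf{ff}$; $a\Downarrow_s\mathsf{tt}$ or $b\Downarrow_s\mathsf{tt}\Rightarrow(a\lor b)\Downarrow_{s+1}\mathsf{tt}$; $a\Downarrow_s\mathsf{ff}$ and $b\Downarrow_s\mathsf{ff}\Rightarrow(a\lor b)\Downarrow_{s+1}\mathsf{ff}$; $t\Downarrow^{\mathrm{hd}}_s\lambda b$, $b[u]\Downarrow_s r\Rightarrow t\cdot u\Downarrow_{s+1}r$; $t\Downarrow^{\mathrm{hd}}_s\mathcal R\,g\,h$, $m\Downarrow_s 0$, $g\Downarrow_s r\Rightarrow t\cdot m\Downarrow_{s+1}r$; $t\Downarrow^{\mathrm{hd}}_s\mathcal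 R\,g\,h$, $m\Downarrow_s k+1$, $h\cdot\underline k\cdot(\mathcal R\cdot g\cdot h\cdot\underline k)\Downarrow_s r\Rightarrow t\cdot m\Downarrow_{s+1}r$. Quantifier: if $t\Downarrow^{\mathrm{hd}}_s\mathcal A$ and $\ulcorner P\urcorner\le s$, then $P\rhd(\{v_0\,\mathsf N\}\vdash\uparrow u\cdot v_0)\Rightarrow t\cdot u\Downarrow_{s+1}\mathsf{tt}$, and $P\rhd(\emptyset\vdash\neg(u\cdot\underline i))$ for some $i\in\mathbb N$ $\Rightarrow t\cdot u\Downarrow_{s+1}\mathsf{ff}$. Heads: $\lambda b\Downarrow^{\mathrm{hd}}_{s+1}\lambda b$; $\mathcal R\Downarrow^{\mathrm{hd}}_{s+1}\mathcal R$; $\mathcal A\Downarrow^{\mathrm{hd}}_{s+1}\mathcal A$; $t\Downarrow^{\mathrm{hd}}_s\mathcal R\Rightarrow t\cdot g\Downarrow^{\mathrm{hd}}_{s+1}\mathcal R\,g$; $t\Downarrow^{\mathrm{hd}}_s\mathcal R\,g\Rightarrow t\cdot h\Downarrow^{\mathrm{hd}}_{s+1}\mathcal R\,g\,h$; and the three clauses for $t\cdot u$, $t\cdot m$ above (heads $\lambda b$ and $\mathcal R\,g\,h$) with the last premise and the conclusion replaced by head evaluation to the same $w$. *)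

theory Defs
  imports Main "HOL-Library.FSet" "HOL-Library.Nat_Bijection"
begin

section \<open>Recursively enumerable sets\<close>

text \<open>
  Codes of partial recursive functions. A code carries no arity: its restriction to argument lists
  of length \<open>n\<close> is an \<open>n\<close>-ary partial recursive function, for each \<open>n\<close>.
\<close>

datatype recf =
    Zer
  | Suc1
  | Proj nat
  | Comp recf "recf list"
  | PrimRec recf recf
  | Mu recf

inductive computes :: "recf \<Rightarrow> nat list \<Rightarrow> nat \<Rightarrow> bool" where
  zer: "computes Zer xs 0"
| suc1: "computes Suc1 [x] (Suc x)"
| proj: "i < length xs \<Longrightarrow> computes (Proj i) xs (xs ! i)"
| comp: "list_all2 (\<lambda>g y. computes g xs y) gs ys \<Longrightarrow> computes f ys z \<Longrightarrow>
    computes (Comp f gs) xs z"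
| primrec_0: "computes g xs z \<Longrightarrow> computes (PrimRec g h) (0 # xs) z"
| primrec_Suc: "computes (PrimRec g h) (n # xs) y \<Longrightarrow> computes h (n # y # xs) z \<Longrightarrow>
    computes (PrimRec g h) (Suc n # xs) z"
| mu: "computes f (n # xs) 0 \<Longrightarrow> (\<forall>i<n. \<exists>y. computes f (i # xs) (Suc y)) \<Longrightarrow>
    computes (Mu f) xs n"

definition recursively_enumerable :: "nat set \<Rightarrow> bool" where
  "recursively_enumerable A \<longleftrightarrow> (\<exists>f. A = {x. \<exists>y. computes f [x] y})"


section \<open>Raw terms\<close>

text \<open>
  \<open>Op f k ts\<close> is the node with operator code \<open>f\<close>, binder count \<open>k\<close> and arguments \<open>ts\<close>. Operator
  codes are arbitrary natural numbers; only the ten nodes abbreviated below occur in well-formed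
  terms.
\<close>

datatype trm = Var nat | Op nat nat "trm list"

abbreviation Bot :: trm where "Bot \<equiv> Op 0 0 []"
abbreviation Zero :: trm where "Zero \<equiv> Op 1 0 []"
abbreviation Rec :: trm where "Rec \<equiv> Op 2 0 []"
abbreviation Quant :: trm where "Quant \<equiv> Op 3 0 []"
abbreviation Sc :: "trm \<Rightarrow> trm" where "Sc t \<equiv> Op 4 0 [t]"
abbreviation Neg :: "trm \<Rightarrow> trm" ("\<^bold>\<not> _" [80] 80) where "\<^bold>\<not> t \<equiv> Op 5 0 [t]"
abbreviation Lam :: "trm \<Rightarrow> trm" where "Lam b \<equiv> Op 6 1 [b]"
abbreviation Eq :: "trm \<Rightarrow> trm \<Rightarrow> trm" (infix "\<^bold>=" 70) where "t \<^bold>= u \<equiv> Op 7 0 [t, u]"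
abbreviation Or :: "trm \<Rightarrow> trm \<Rightarrow> trm" (infixr "\<^bold>\<or>" 65) where "t \<^bold>\<or> u \<equiv> Op 8 0 [t, u]"
abbreviation App :: "trm \<Rightarrow> trm \<Rightarrow> trm" (infixl "\<cdot>" 90) where "t \<cdot> u \<equiv> Op 9 0 [t, u]"

text \<open>Triples of operator code, binder count and arity.\<close>

definition signature :: "(nat \<times> nat \<times> nat) set" where
  "signature = {(0, 0, 0), (1, 0, 0), (2, 0, 0), (3, 0, 0), (4, 0, 1), (5, 0, 1), (6, 1, 1),
     (7, 0, 2), (8, 0, 2), (9, 0, 2)}"

fun well_formed :: "trm \<Rightarrow> bool" where
  "well_formed (Var i) \<longleftrightarrow> True"
| "well_formed (Op f k ts) \<longleftrightarrow> (f, k, length ts) \<in> signature \<and> (\<forall>t\<in>set ts. well_formed t)"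

fun fv :: "trm \<Rightarrow> nat set" where
  "fv (Var i) = {i}"
| "fv (Op f k ts) = (\<Union>t\<in>set ts. {i. i + k \<in> fv t})"

text \<open>\<open>shift d c t\<close> adds \<open>d\<close> to every free index of \<open>t\<close> that is at least \<open>c\<close>.\<close>

fun shift :: "nat \<Rightarrow> nat \<Rightarrow> trm \<Rightarrow> trm" where
  "shift d c (Var i) = Var (if i < c then i else i + d)"
| "shift d c (Op f k ts) = Op f k (map (shift d (c + k)) ts)"

abbreviation up :: "trm \<Rightarrow> trm" ("\<up> _" [100] 100) where "\<up> t \<equiv> shift 1 0 t"

text \<open>\<open>subst i s t\<close> is \<open>[v\<^sub>i \<mapsto> s]t\<close>; no index is decremented.\<close>

fun subst :: "nat \<Rightarrow> trm \<Rightarrow> trm \<Rightarrow> trm" where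
  "subst i s (Var j) = (if j = i then s else Var j)"
| "subst i s (Op f k ts) = Op f k (map (subst (i + k) (shift k 0 s)) ts)"

fun inst_at :: "nat \<Rightarrow> trm \<Rightarrow> trm \<Rightarrow> trm" where
  "inst_at i s (Var j) = (if j < i then Var j else if j = i then s else Var (j - 1))"
| "inst_at i s (Op f k ts) = Op f k (map (inst_at (i + k) (shift k 0 s)) ts)"

text \<open>\<open>inst b t\<close> is the \<open>\<beta>\<close>-instance \<open>b[t]\<close>.\<close>

abbreviation inst :: "trm \<Rightarrow> trm \<Rightarrow> trm" where "inst b t \<equiv> inst_at 0 t b"

primrec natnum :: "nat \<Rightarrow> trm" where
  "natnum 0 = Zero"
| "natnum (Suc n) = Sc (natnum n)"

abbreviation Neq :: "trm \<Rightarrow> trm \<Rightarrow> trm" (infix "\<^bold>\<noteq>" 70) where "t \<^bold>\<noteq> u \<equiv> \<^bold>\<not> (t \<^bold>= u)"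
abbreviation IsNat :: "trm \<Rightarrow> trm" where "IsNat t \<equiv> t \<^bold>= t"
abbreviation IsBool :: "trm \<Rightarrow> trm" where "IsBool t \<equiv> t \<^bold>\<or> \<^bold>\<not> t"
abbreviation Conj :: "trm \<Rightarrow> trm \<Rightarrow> trm" (infixr "\<^bold>\<and>" 67) where
  "t \<^bold>\<and> u \<equiv> \<^bold>\<not> (\<^bold>\<not> t \<^bold>\<or> \<^bold>\<not> u)"

inductive head_step :: "trm \<Rightarrow> trm \<Rightarrow> bool" (infix "\<triangleright>" 50) where
  beta: "well_formed t \<Longrightarrow> Lam b \<cdot> t \<triangleright> inst b t"
| rec_0: "well_formed h \<Longrightarrow> Rec \<cdot> g \<cdot> h \<cdot> Zero \<triangleright> g"
| rec_Sc: "well_formed g \<Longrightarrow>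
    Rec \<cdot> g \<cdot> h \<cdot> Sc (natnum n) \<triangleright> h \<cdot> natnum n \<cdot> (Rec \<cdot> g \<cdot> h \<cdot> natnum n)"
| app: "t \<triangleright> t' \<Longrightarrow> t \<cdot> u \<triangleright> t' \<cdot> u"


section \<open>Proofs\<close>

datatype sequent = Sequent "trm fset" trm (infix "\<turnstile>" 45)

text \<open>
  \<open>follows E J\<close>: the sequent \<open>J\<close> follows by one rule from premises in \<open>E\<close>.
\<close>

inductive follows :: "sequent set \<Rightarrow> sequent \<Rightarrow> bool" for E :: "sequent set" where
  hyp: "well_formed c \<Longrightarrow> follows E (finsert c \<Gamma> \<turnstile> c)"
| weaken: "(\<Gamma> \<turnstile> c) \<in> E \<Longrightarrow> follows E (finsert a \<Gamma> \<turnstile> c)"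
| cut: "(\<Gamma> \<turnstile> a) \<in> E \<Longrightarrow> (finsert a \<Gamma> \<turnstile> c) \<in> E \<Longrightarrow> follows E (\<Gamma> \<turnstile> c)"
| substitution: "(\<Gamma> \<turnstile> c) \<in> E \<Longrightarrow> fBall \<Gamma> well_formed \<Longrightarrow> well_formed c \<Longrightarrow> well_formed s \<Longrightarrow>
    follows E (subst v s |`| \<Gamma> \<turnstile> subst v s c)"

| true_eqI: "(\<Gamma> \<turnstile> a) \<in> E \<Longrightarrow> follows E (\<Gamma> \<turnstile> a \<^bold>= natnum 1)"
| true_eqD: "(\<Gamma> \<turnstile> a \<^bold>= natnum 1) \<in> E \<Longrightarrow> follows E (\<Gamma> \<turnstile> a)"
| false_eqI: "(\<Gamma> \<turnstile> \<^bold>\<not> a) \<in> E \<Longrightarrow> follows E (\<Gamma> \<turnstile> a \<^bold>= natnum 0)"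
| false_eqD: "(\<Gamma> \<turnstile> a \<^bold>= natnum 0) \<in> E \<Longrightarrow> follows E (\<Gamma> \<turnstile> \<^bold>\<not> a)"

| neg_elim: "(\<Gamma> \<turnstile> \<^bold>\<not> a) \<in> E \<Longrightarrow> (\<Gamma> \<turnstile> a) \<in> E \<Longrightarrow> well_formed c \<Longrightarrow> follows E (\<Gamma> \<turnstile> c)"
| neg_negI: "(\<Gamma> \<turnstile> a) \<in> E \<Longrightarrow> follows E (\<Gamma> \<turnstile> \<^bold>\<not> (\<^bold>\<not> a))"
| neg_negD: "(\<Gamma> \<turnstile> \<^bold>\<not> (\<^bold>\<not> a)) \<in> E \<Longrightarrow> follows E (\<Gamma> \<turnstile> a)"

| disjI1: "(\<Gamma> \<turnstile> a) \<in> E \<Longrightarrow> well_formed b \<Longrightarrow> follows E (\<Gamma> \<turnstile> a \<^bold>\<or> b)"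
| disjI2: "(\<Gamma> \<turnstile> b) \<in> E \<Longrightarrow> well_formed a \<Longrightarrow> follows E (\<Gamma> \<turnstile> a \<^bold>\<or> b)"
| neg_disjI: "(\<Gamma> \<turnstile> \<^bold>\<not> a) \<in> E \<Longrightarrow> (\<Gamma> \<turnstile> \<^bold>\<not> b) \<in> E \<Longrightarrow> follows E (\<Gamma> \<turnstile> \<^bold>\<not> (a \<^bold>\<or> b))"
| disjE: "(\<Gamma> \<turnstile> a \<^bold>\<or> b) \<in> E \<Longrightarrow> (finsert a \<Gamma> \<turnstile> c) \<in> E \<Longrightarrow> (finsert b \<Gamma> \<turnstile> c) \<in> E \<Longrightarrow>
    follows E (\<Gamma> \<turnstile> c)"
| neg_disjD1: "(\<Gamma> \<turnstile> \<^bold>\<not> (a \<^bold>\<or> b)) \<in> E \<Longrightarrow> follows E (\<Gamma> \<turnstile> \<^bold>\<not> a)"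
| neg_disjD2: "(\<Gamma> \<turnstile> \<^bold>\<not> (a \<^bold>\<or> b)) \<in> E \<Longrightarrow> follows E (\<Gamma> \<turnstile> \<^bold>\<not> b)"

\<comment> \<open>\<open>IsNat a\<close> abbreviates \<open>a \<^bold>= a\<close>, so both directions of this rule are the same.\<close>
| nat_eq: "(\<Gamma> \<turnstile> IsNat a) \<in> E \<Longrightarrow> follows E (\<Gamma> \<turnstile> a \<^bold>= a)"
| eq_sym: "(\<Gamma> \<turnstile> a \<^bold>= b) \<in> E \<Longrightarrow> follows E (\<Gamma> \<turnstile> b \<^bold>= a)"
| eq_subst: "(\<Gamma> \<turnstile> a \<^bold>= b) \<in> E \<Longrightarrow> (\<Gamma> \<turnstile> subst v a p) \<in> E \<Longrightarrow> well_formed p \<Longrightarrow>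
    follows E (\<Gamma> \<turnstile> subst v b p)"
| neq_sym: "(\<Gamma> \<turnstile> a \<^bold>\<noteq> b) \<in> E \<Longrightarrow> follows E (\<Gamma> \<turnstile> b \<^bold>\<noteq> a)"
| eq_boolI: "(\<Gamma> \<turnstile> IsNat a) \<in> E \<Longrightarrow> (\<Gamma> \<turnstile> IsNat b) \<in> E \<Longrightarrow> follows E (\<Gamma> \<turnstile> IsBool (a \<^bold>= b))"
| eq_boolD: "(\<Gamma> \<turnstile> IsBool (a \<^bold>= b)) \<in> E \<Longrightarrow> follows E (\<Gamma> \<turnstile> IsNat a \<^bold>\<and> IsNat b)"

| zero_nat: "follows E (\<Gamma> \<turnstile> IsNat Zero)"
| Sc_natI: "(\<Gamma> \<turnstile> IsNat a) \<in> E \<Longrightarrow> follows E (\<Gamma> \<turnstile> IsNat (Sc a))"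
| Sc_natD: "(\<Gamma> \<turnstile> IsNat (Sc a)) \<in> E \<Longrightarrow> follows E (\<Gamma> \<turnstile> IsNat a)"
| Sc_neq_zero: "(\<Gamma> \<turnstile> IsNat a) \<in> E \<Longrightarrow> follows E (\<Gamma> \<turnstile> Sc a \<^bold>\<noteq> Zero)"
| Sc_neqI: "(\<Gamma> \<turnstile> a \<^bold>\<noteq> b) \<in> E \<Longrightarrow> follows E (\<Gamma> \<turnstile> Sc a \<^bold>\<noteq> Sc b)"
| Sc_neqD: "(\<Gamma> \<turnstile> Sc a \<^bold>\<noteq> Sc b) \<in> E \<Longrightarrow> follows E (\<Gamma> \<turnstile> a \<^bold>\<noteq> b)"
| Sc_eqD: "(\<Gamma> \<turnstile> Sc a \<^bold>= Sc b) \<in> E \<Longrightarrow> follows E (\<Gamma> \<turnstile> a \<^bold>= b)"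
| bot_nat: "(\<Gamma> \<turnstile> IsNat Bot) \<in> E \<Longrightarrow> well_formed p \<Longrightarrow> follows E (\<Gamma> \<turnstile> p)"

| induction: "(\<Gamma> \<turnstile> subst i Zero c) \<in> E \<Longrightarrow>
    (finsert (IsNat (Var i)) (finsert c \<Gamma>) \<turnstile> subst i (Sc (Var i)) c) \<in> E \<Longrightarrow>
    (\<Gamma> \<turnstile> IsNat a) \<in> E \<Longrightarrow> well_formed c \<Longrightarrow> fBall \<Gamma> (\<lambda>t. i \<notin> fv t) \<Longrightarrow>
    follows E (\<Gamma> \<turnstile> subst i a c)"

| conv_expand: "c \<triangleright> c' \<Longrightarrow> (\<Gamma> \<turnstile> c') \<in> E \<Longrightarrow> follows E (\<Gamma> \<turnstile> c)"
| conv_reduce: "c \<triangleright> c' \<Longrightarrow> (\<Gamma> \<turnstile> c) \<in> E \<Longrightarrow> follows E (\<Gamma> \<turnstile> c')"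
| conv_eq: "c \<triangleright> c' \<Longrightarrow> (\<Gamma> \<turnstile> IsNat c') \<in> E \<Longrightarrow> follows E (\<Gamma> \<turnstile> c \<^bold>= c')"

| recursor: "(\<Gamma> \<turnstile> IsNat m) \<in> E \<Longrightarrow> (\<Gamma> \<turnstile> IsNat (h \<cdot> m \<cdot> (Rec \<cdot> g \<cdot> h \<cdot> m))) \<in> E \<Longrightarrow>
    well_formed g \<Longrightarrow>
    follows E (\<Gamma> \<turnstile> Rec \<cdot> g \<cdot> h \<cdot> Sc m \<^bold>= h \<cdot> m \<cdot> (Rec \<cdot> g \<cdot> h \<cdot> m))"

| allI: "(finsert (IsNat (Var 0)) (up |`| \<Gamma>) \<turnstile> \<up> f \<cdot> Var 0) \<in> E \<Longrightarrow> follows E (\<Gamma> \<turnstile> Quant \<cdot> f)"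
| allE: "(\<Gamma> \<turnstile> Quant \<cdot> f) \<in> E \<Longrightarrow> (\<Gamma> \<turnstile> IsNat a) \<in> E \<Longrightarrow> follows E (\<Gamma> \<turnstile> f \<cdot> a)"
| neg_allI: "(\<Gamma> \<turnstile> \<^bold>\<not> (f \<cdot> a)) \<in> E \<Longrightarrow> (\<Gamma> \<turnstile> IsNat a) \<in> E \<Longrightarrow>
    follows E (\<Gamma> \<turnstile> \<^bold>\<not> (Quant \<cdot> f))"
| neg_allE: "(\<Gamma> \<turnstile> \<^bold>\<not> (Quant \<cdot> f)) \<in> E \<Longrightarrow>
    (finsert (IsNat (Var 0)) (finsert (\<^bold>\<not> (\<up> f \<cdot> Var 0)) (up |`| \<Gamma>)) \<turnstile> \<up> c) \<in> E \<Longrightarrow>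
    follows E (\<Gamma> \<turnstile> c)"

definition is_proof :: "sequent list \<Rightarrow> bool" where
  "is_proof P \<longleftrightarrow> (\<forall>i<length P. follows (set (take i P)) (P ! i))"

definition proves :: "sequent list \<Rightarrow> sequent \<Rightarrow> bool" (infix "\<rhd>" 40) where
  "P \<rhd> J \<longleftrightarrow> is_proof P \<and> J \<in> set P"


section \<open>Goedel codings\<close>

fun code_trm :: "trm \<Rightarrow> nat" where
  "code_trm (Var i) = sum_encode (Inl i)"
| "code_trm (Op f k ts) =
     sum_encode (Inr (prod_encode (f, prod_encode (k, list_encode (map code_trm ts)))))"

fun code_sequent :: "sequent \<Rightarrow> nat" where
  "code_sequent (\<Gamma> \<turnstile> c) = prod_encode (set_encode (code_trm ` fset \<Gamma>), code_trm c)"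

definition code_proof :: "sequent list \<Rightarrow> nat" where
  "code_proof P = list_encode (map code_sequent P)"

lemma code_trm_eqD: "code_trm t = code_trm u \<Longrightarrow> t = u"
proof (induction t arbitrary: u)
  case (Var i)
  then show ?case by (cases u) (auto simp: sum_encode_eq list_encode_eq)
next
  case (Op f k ts)
  then obtain us where u: "u = Op f k us" and eq: "map code_trm ts = map code_trm us"
    by (cases u) (auto simp: sum_encode_eq list_encode_eq)
  have "ts = us"
    using eq Op.IH by (auto simp: list_eq_iff_nth_eq)
  with u show ?case by simp
qed

lemma inj_code_trm: "inj code_trm"
  by (rule injI) (rule code_trm_eqD)

lemma inj_code_sequent: "inj code_sequent"
proof (rule injI)
  fix J K assume eq: "code_sequent J = code_sequent K"
  obtain \<Gamma> c \<Delta> d where JK: "J = (\<Gamma> \<turnstile> c)" "K = (\<Delta> \<turnstile> d)"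
    by (cases J, cases K) auto
  from eq JK have "code_trm ` fset \<Gamma> = code_trm ` fset \<Delta>" "code_trm c = code_trm d"
    by (auto simp: set_encode_eq)
  with inj_code_trm JK show "J = K"
    by (auto simp: inj_image_eq_iff fset_inject dest: code_trm_eqD)
qed

lemma inj_code_proof: "inj code_proof"
  by (rule injI) (auto simp: code_proof_def list_encode_eq inj_map_eq_map[OF inj_code_sequent])


section \<open>Evaluation\<close>

abbreviation tt :: nat where "tt \<equiv> 1"
abbreviation ff :: nat where "ff \<equiv> 0"

datatype head_shape =
    HLam trm
  | HRec
  | HRec1 trm
  | HRec2 trm trm
  | HQuant

inductive
  evaluates :: "trm \<Rightarrow> nat \<Rightarrow> nat \<Rightarrow> bool" ("_ \<Down>[_] _" [50, 0, 50] 50) and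
  head_evaluates :: "trm \<Rightarrow> nat \<Rightarrow> head_shape \<Rightarrow> bool" ("_ \<Down>hd[_] _" [50, 0, 50] 50)
where
  zero: "Zero \<Down>[Suc s] 0"
| Sc: "a \<Down>[s] n \<Longrightarrow> Sc a \<Down>[Suc s] Suc n"
| eq: "a \<Down>[s] m \<Longrightarrow> b \<Down>[s] n \<Longrightarrow> (a \<^bold>= b) \<Down>[Suc s] (if m = n then tt else ff)"
| neg_ff: "a \<Down>[s] ff \<Longrightarrow> (\<^bold>\<not> a) \<Down>[Suc s] tt"
| neg_tt: "a \<Down>[s] tt \<Longrightarrow> (\<^bold>\<not> a) \<Down>[Suc s] ff"
| or_tt1: "a \<Down>[s] tt \<Longrightarrow> (a \<^bold>\<or> b) \<Down>[Suc s] tt"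
| or_tt2: "b \<Down>[s] tt \<Longrightarrow> (a \<^bold>\<or> b) \<Down>[Suc s] tt"
| or_ff: "a \<Down>[s] ff \<Longrightarrow> b \<Down>[s] ff \<Longrightarrow> (a \<^bold>\<or> b) \<Down>[Suc s] ff"
| beta: "t \<Down>hd[s] HLam b \<Longrightarrow> inst b u \<Down>[s] r \<Longrightarrow> (t \<cdot> u) \<Down>[Suc s] r"
| rec_0: "t \<Down>hd[s] HRec2 g h \<Longrightarrow> m \<Down>[s] 0 \<Longrightarrow> g \<Down>[s] r \<Longrightarrow> (t \<cdot> m) \<Down>[Suc s] r"
| rec_Suc: "t \<Down>hd[s] HRec2 g h \<Longrightarrow> m \<Down>[s] Suc k \<Longrightarrow>
    (h \<cdot> natnum k \<cdot> (Rec \<cdot> g \<cdot> h \<cdot> natnum k)) \<Down>[s] r \<Longrightarrow> (t \<cdot> m) \<Down>[Suc s] r"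

| all_tt: "t \<Down>hd[s] HQuant \<Longrightarrow> code_proof P \<le> s \<Longrightarrow>
    P \<rhd> ({|IsNat (Var 0)|} \<turnstile> \<up> u \<cdot> Var 0) \<Longrightarrow> (t \<cdot> u) \<Down>[Suc s] tt"
| all_ff: "t \<Down>hd[s] HQuant \<Longrightarrow> code_proof P \<le> s \<Longrightarrow>
    P \<rhd> ({||} \<turnstile> \<^bold>\<not> (u \<cdot> natnum i)) \<Longrightarrow> (t \<cdot> u) \<Down>[Suc s] ff"

| hd_Lam: "Lam b \<Down>hd[Suc s] HLam b"
| hd_Rec: "Rec \<Down>hd[Suc s] HRec"
| hd_All: "Quant \<Down>hd[Suc s] HQuant"
| hd_Rec1: "t \<Down>hd[s] HRec \<Longrightarrow> (t \<cdot> g) \<Down>hd[Suc s] HRec1 g"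
| hd_Rec2: "t \<Down>hd[s] HRec1 g \<Longrightarrow> (t \<cdot> h) \<Down>hd[Suc s] HRec2 g h"
| hd_beta: "t \<Down>hd[s] HLam b \<Longrightarrow> inst b u \<Down>hd[s] w \<Longrightarrow> (t \<cdot> u) \<Down>hd[Suc s] w"
| hd_rec_0: "t \<Down>hd[s] HRec2 g h \<Longrightarrow> m \<Down>[s] 0 \<Longrightarrow> g \<Down>hd[s] w \<Longrightarrow> (t \<cdot> m) \<Down>hd[Suc s] w"
| hd_rec_Suc: "t \<Down>hd[s] HRec2 g h \<Longrightarrow> m \<Down>[s] Suc k \<Longrightarrow>
    (h \<cdot> natnum k \<cdot> (Rec \<cdot> g \<cdot> h \<cdot> natnum k)) \<Down>hd[s] w \<Longrightarrow> (t \<cdot> m) \<Down>hd[Suc s] w"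

definition grounded_true :: "trm \<Rightarrow> bool" where
  "grounded_true c \<longleftrightarrow> (\<exists>s. c \<Down>[s] tt)"

end

theory Submission
  imports Defs
begin

text \<open>
  Grounded truth is semidecidable because everything it rests on is an inductive definition with
  finitely many premises per rule. Evaluation is generated by the evaluation clauses; the two
  quantifier clauses ask for a proof, and a proof is generated by appending judgments that follow
  from earlier ones. An element of an inductively defined set has a finite derivation, and a machine
  can search for it provided that it can recognise the instances of the rules.

  To make this precise, each relevant type is put in bijection with the natural numbers by a class
  whose instance for terms is the given Goedel coding. A function is computable if some code
  computes it on these numbers, and a predicate is semidecidable if it is the projection of a zero
  set of a computable function; unbounded minimization turns such a predicate into a recursively
  enumerable set (\<open>recursively_enumerable_if_semidec\<close>). Semidecidable predicates are closed under
  conjunction, disjunction, existential and bounded universal quantification. Hence "the list is a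
  derivation" is semidecidable whenever the rules are, which gives the lemma that carries the proof,
  \<open>semidec_generated\<close>: a set generated by semidecidable rules is semidecidable.

  A total function with a semidecidable graph is computable, since one can search for its value.
  So recursive functions on terms (shifting, substitution, instantiation) and operations on coded
  finite sets need no machine programs either: it is enough to generate their graphs
  (\<open>computable_if_generated\<close>). Once these are available, the rule system of the calculus, and that
  of evaluation, is a disjunction of existentially quantified equations between computable
  functions, with semidecidable side conditions.
\<close>

section \<open>Basic recursive functions\<close>

inductive_cases computes_ZerE: "computes Zer xs z"
inductive_cases computes_Suc1E: "computes Suc1 xs z"
inductive_cases computes_ProjE: "computes (Proj i) xs z"
inductive_cases computes_CompE: "computes (Comp f gs) xs z"
inductive_cases computes_PrimRec_0E: "computes (PrimRec g h) (0 # xs) z"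
inductive_cases computes_PrimRec_SucE: "computes (PrimRec g h) (Suc n # xs) z"
inductive_cases computes_MuE: "computes (Mu f) xs z"

text \<open>
  Determinism is what makes a halting minimization informative: if the search \<open>Mu f\<close> stops, then
  the function computed by \<open>f\<close> really has a zero.
\<close>

lemma computes_functional: "computes f xs y \<Longrightarrow> computes f xs z \<Longrightarrow> y = z"
proof (induction arbitrary: z rule: computes.induct)
  case (zer xs)
  then show ?case by (rule computes_ZerE) simp
next
  case (suc1 x)
  then show ?case by (rule computes_Suc1E) simp
next
  case (proj i xs)
  from proj(2) show ?case by (rule computes_ProjE) simp
next
  case (comp xs gs ys f y)
  from comp.prems obtain ys' where ys': "list_all2 (\<lambda>g y. computes g xs y) gs ys'"
    and z: "computes f ys' z"
    by (rule computes_CompE)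
  have "ys = ys'"
    using comp.IH(1) ys' by (auto simp: list_all2_conv_all_nth intro!: nth_equalityI)
  with comp.IH(2) z show ?case by blast
next
  case (primrec_0 g xs y h)
  from primrec_0.prems have "computes g xs z" by (rule computes_PrimRec_0E)
  then show ?case by (rule primrec_0.IH)
next
  case (primrec_Suc g h n xs y z')
  from primrec_Suc.prems obtain y' where y': "computes (PrimRec g h) (n # xs) y'"
    and z: "computes h (n # y' # xs) z"
    by (rule computes_PrimRec_SucE)
  from y' have "y = y'" by (rule primrec_Suc.IH(1))
  with z show ?case using primrec_Suc.IH(2) by simp
next
  case (mu f n xs)
  from mu.prems have z: "computes f (z # xs) 0 \<and> (\<forall>i<z. \<exists>y. computes f (i # xs) (Suc y))"
    by (rule computes_MuE) blast
  have "\<not> n < z"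
  proof
    assume "n < z"
    with z obtain y where "computes f (n # xs) (Suc y)" by blast
    then have "0 = Suc y" by (rule mu.IH(1))
    then show False by simp
  qed
  moreover have "\<not> z < n"
  proof
    assume "z < n"
    with mu.IH(2) obtain y where "\<forall>u. computes f (z # xs) u \<longrightarrow> Suc y = u" by blast
    with z show False by blast
  qed
  ultimately show ?case by simp
qed

lemma computes_Comp1:
  "computes g xs a \<Longrightarrow> computes f [a] z \<Longrightarrow> computes (Comp f [g]) xs z"
  by (rule computes.comp[where ys = "[a]"]) auto

lemma computes_Comp2:
  "computes g xs a \<Longrightarrow> computes h xs b \<Longrightarrow> computes f [a, b] z \<Longrightarrow> computes (Comp f [g, h]) xs z"
  by (rule computes.comp[where ys = "[a, b]"]) auto

lemma computes_Proj0: "computes (Proj 0) (x # xs) x"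
  using computes.proj[of 0 "x # xs"] by simp

lemma computes_Proj1: "computes (Proj 1) (x # y # xs) y"
  using computes.proj[of 1 "x # y # xs"] by simp

lemma computes_Proj2: "computes (Proj 2) (x # y # z # xs) z"
  using computes.proj[of 2 "x # y # z # xs"] by simp

lemmas computes_intros = computes_Proj0 computes_Proj1 computes_Proj2 computes_Comp1 computes_Comp2
  computes.suc1 computes.zer

definition add_code :: recf where
  "add_code = PrimRec (Proj 0) (Comp Suc1 [Proj 1])"

lemma computes_add: "computes add_code [m, n] (m + n)"
  unfolding add_code_def
proof (induction m)
  case 0
  show ?case by (simp add: computes.primrec_0 computes_Proj0)
next
  case (Suc m)
  have "computes (Comp Suc1 [Proj 1]) [m, m + n, n] (Suc (m + n))"
    by (rule computes_intros)+
  then show ?case using computes.primrec_Suc[OF Suc] by simp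
qed

definition pred_code :: recf where
  "pred_code = PrimRec Zer (Proj 0)"

lemma computes_pred: "computes pred_code [n] (n - 1)"
  unfolding pred_code_def
proof (induction n)
  case (Suc n)
  show ?case using computes.primrec_Suc[OF Suc computes_Proj0] by simp
qed (simp add: computes.primrec_0 computes.zer)

definition sub_code :: recf where
  "sub_code = PrimRec (Proj 0) (Comp pred_code [Proj 1])"

lemma computes_sub: "computes sub_code [n, m] (m - n)"
  unfolding sub_code_def
proof (induction n)
  case 0
  show ?case by (simp add: computes.primrec_0 computes_Proj0)
next
  case (Suc n)
  have "computes (Comp pred_code [Proj 1]) [n, m - n, m] (m - n - 1)"
    by (rule computes_intros computes_pred)+
  then show ?case using computes.primrec_Suc[OF Suc] by simp
qed

definition triangle_code :: recf where
  "triangle_code = PrimRec Zer (Comp add_code [Proj 1, Comp Suc1 [Proj 0]])"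

lemma computes_triangle: "computes triangle_code [n] (triangle n)"
  unfolding triangle_code_def
proof (induction n)
  case (Suc n)
  have "computes (Comp add_code [Proj 1, Comp Suc1 [Proj 0]]) [n, triangle n] (triangle n + Suc n)"
    by (rule computes_intros computes_add)+
  then show ?case using computes.primrec_Suc[OF Suc] by simp
qed (simp add: computes.primrec_0 computes.zer)

definition pair_code :: recf where
  "pair_code = Comp add_code [Comp triangle_code [add_code], Proj 0]"

lemma computes_pair: "computes pair_code [a, b] (prod_encode (a, b))"
  unfolding pair_code_def prod_encode_def prod.case
  by (rule computes_intros computes_add computes_triangle)+

text \<open>
  Inverting the pairing \<open>prod_encode (a, b) = triangle (a + b) + a\<close> needs one search, for the diagonal
  \<open>a + b\<close> on which the pair lies: the least \<open>k\<close> with \<open>prod_encode (a, b) < triangle (k + 1)\<close>. Both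
  projections are arithmetic in it.
\<close>

definition diagonal_code :: recf where
  "diagonal_code = Mu (Comp sub_code [Comp triangle_code [Comp Suc1 [Proj 0]], Comp Suc1 [Proj 1]])"

lemma triangle_mono: "m \<le> n \<Longrightarrow> triangle m \<le> triangle n"
  by (induction rule: dec_induct) auto

lemma computes_diagonal: "computes diagonal_code [prod_encode (a, b)] (a + b)"
proof -
  let ?n = "prod_encode (a, b)"
  let ?c = "Comp sub_code [Comp triangle_code [Comp Suc1 [Proj 0]], Comp Suc1 [Proj 1]]"
  have c: "computes ?c [k, ?n] (Suc ?n - triangle (Suc k))" for k
    by (rule computes_intros computes_sub computes_triangle)+
  have zero: "Suc ?n - triangle (Suc (a + b)) = 0"
    by (simp add: prod_encode_def)
  have "computes ?c [k, ?n] (Suc (?n - triangle (Suc k)))" if "k < a + b" for k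
  proof -
    have "triangle (Suc k) \<le> ?n"
      using triangle_mono[of "Suc k" "a + b"] that by (simp add: prod_encode_def)
    then show ?thesis using c[of k] by (simp only: Suc_diff_le)
  qed
  then show ?thesis
    using c[of "a + b"] zero unfolding diagonal_code_def by (intro computes.mu) auto
qed

definition fst_code :: recf where
  "fst_code = Comp sub_code [Comp triangle_code [diagonal_code], Proj 0]"

lemma computes_fst: "computes fst_code [prod_encode (a, b)] a"
proof -
  have "computes fst_code [prod_encode (a, b)] (prod_encode (a, b) - triangle (a + b))"
    unfolding fst_code_def
    by (rule computes_intros computes_sub computes_triangle computes_diagonal)+
  then show ?thesis by (simp add: prod_encode_def)
qed

definition snd_code :: recf where
  "snd_code = Comp sub_code [fst_code, diagonal_code]"

lemma computes_snd: "computes snd_code [prod_encode (a, b)] b"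
proof -
  have "computes snd_code [prod_encode (a, b)] (a + b - a)"
    unfolding snd_code_def by (rule computes_Comp2 computes_sub computes_fst computes_diagonal)+
  then show ?thesis by simp
qed


section \<open>Types in bijection with the natural numbers\<close>

text \<open>
  The coding is required to be onto, not only injective. Then a search over natural numbers is a
  search over the elements of the type, and no test for being a code is ever needed.
\<close>

class coded =
  fixes enc :: "'a \<Rightarrow> nat"
  assumes bij_enc: "bij enc"
begin

lemma enc_eq_iff: "enc x = enc y \<longleftrightarrow> x = y"
  using bij_enc by (auto dest: bij_is_inj injD)

lemma enc_cases: obtains x where "n = enc x"
  using bij_enc by (metis bij_pointE)

end

lemma bij_encI:
  "(\<And>x y. e x = e y \<Longrightarrow> x = y) \<Longrightarrow> (\<And>n. \<exists>x. e x = n) \<Longrightarrow> bij e"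
  by (metis bijI injI surjI)

instantiation nat :: coded
begin
definition enc_nat :: "nat \<Rightarrow> nat" where "enc_nat n = n"
instance by standard (auto simp: enc_nat_def intro: bij_encI)
end

instantiation prod :: (coded, coded) coded
begin
definition enc_prod :: "'a \<times> 'b \<Rightarrow> nat" where
  "enc_prod p = prod_encode (enc (fst p), enc (snd p))"
instance
proof (standard, rule bij_encI)
  fix n
  obtain a b where "n = prod_encode (a, b)" by (metis prod_decode_inverse surj_pair)
  moreover obtain x :: 'a and y :: 'b where "a = enc x" "b = enc y" by (metis enc_cases)
  ultimately have "enc (x, y) = n" by (simp add: enc_prod_def)
  then show "\<exists>p :: 'a \<times> 'b. enc p = n" ..
qed (auto simp: enc_prod_def enc_eq_iff prod_eq_iff)
end

instantiation sum :: (coded, coded) coded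
begin
definition enc_sum :: "'a + 'b \<Rightarrow> nat" where
  "enc_sum s = sum_encode (map_sum enc enc s)"
instance
proof (standard, rule bij_encI)
  fix n
  obtain s where "n = sum_encode s" by (metis sum_decode_inverse)
  then show "\<exists>p :: 'a + 'b. enc p = n"
  proof (cases s)
    case (Inl a)
    then show ?thesis using \<open>n = _\<close> enc_cases[of a] by (metis enc_sum_def map_sum.simps(1))
  next
    case (Inr b)
    then show ?thesis using \<open>n = _\<close> enc_cases[of b] by (metis enc_sum_def map_sum.simps(2))
  qed
next
  fix s t :: "'a + 'b"
  assume "enc s = enc t"
  then show "s = t" by (cases s; cases t) (auto simp: enc_sum_def enc_eq_iff sum_encode_eq)
qed
end

instantiation list :: (coded) coded
begin
definition enc_list :: "'a list \<Rightarrow> nat" where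
  "enc_list xs = list_encode (map enc xs)"
instance
proof (standard, rule bij_encI)
  fix n
  obtain ns where n: "n = list_encode ns" by (metis list_decode_inverse)
  have "\<exists>xs :: 'a list. ns = map enc xs"
    by (induction ns) (auto simp: Cons_eq_map_conv intro: enc_cases)
  with n show "\<exists>xs :: 'a list. enc xs = n" by (auto simp: enc_list_def)
next
  fix xs ys :: "'a list"
  assume "enc xs = enc ys"
  then show "xs = ys"
    by (simp add: enc_list_def list_encode_eq inj_map_eq_map[OF bij_is_inj[OF bij_enc]])
qed
end

instantiation fset :: (coded) coded
begin
definition enc_fset :: "'a fset \<Rightarrow> nat" where
  "enc_fset A = set_encode (enc ` fset A)"
instance
proof (standard, rule bij_encI)
  fix n
  let ?A = "inv enc ` set_decode n :: 'a set"
  have "enc ` ?A = set_decode n"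
    by (simp add: image_image surj_f_inv_f[OF bij_is_surj[OF bij_enc]])
  then have "enc (Abs_fset ?A) = n"
    by (simp add: enc_fset_def Abs_fset_inverse)
  then show "\<exists>A :: 'a fset. enc A = n" ..
next
  fix A B :: "'a fset"
  assume "enc A = enc B"
  then show "A = B"
    by (simp add: enc_fset_def set_encode_eq inj_image_eq_iff[OF bij_is_inj[OF bij_enc]] fset_inject)
qed
end

text \<open>
  Every number is the code of a term: undoing one layer of sum, pair and list coding leads to
  strictly smaller numbers, so the subterms exist by induction.
\<close>

instantiation trm :: coded
begin
definition enc_trm :: "trm \<Rightarrow> nat" where "enc_trm = code_trm"
instance
proof (standard, rule bij_encI)
  have less: "m < list_encode ns" if "m \<in> set ns" for m ns
    using that
    by (induction ns)
       (auto simp: less_Suc_eq_le le_prod_encode_1 intro: order.strict_implies_order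
         order.trans[OF _ le_prod_encode_2])
  fix n
  show "\<exists>t :: trm. enc t = n"
    unfolding enc_trm_def
  proof (induction n rule: less_induct)
    case (less n)
    obtain s where n: "n = sum_encode s" by (metis sum_decode_inverse)
    show ?case
    proof (cases s)
      case (Inl i)
      then show ?thesis using n by (intro exI[of _ "Var i"]) simp
    next
      case (Inr m)
      obtain f k ns where m: "m = prod_encode (f, prod_encode (k, list_encode ns))"
        by (metis list_decode_inverse prod_decode_inverse surj_pair)
      have "list_encode ns \<le> m"
        unfolding m by (rule order.trans[OF le_prod_encode_2 le_prod_encode_2])
      then have "list_encode ns < n" using n Inr by (simp add: sum_encode_def)
      with less \<open>\<And>m ns. m \<in> set ns \<Longrightarrow> m < list_encode ns\<close>
      have "\<forall>m\<in>set ns. \<exists>t. code_trm t = m" by (meson order.strict_trans)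
      then obtain g where "\<forall>m\<in>set ns. code_trm (g m) = m" by metis
      then have "map code_trm (map g ns) = ns" by (simp add: map_idI)
      then show ?thesis
        using n Inr m by (intro exI[of _ "Op f k (map g ns)"]) simp
    qed
  qed
qed (auto simp: enc_trm_def dest: code_trm_eqD)
end

instantiation sequent :: coded
begin
definition enc_sequent :: "sequent \<Rightarrow> nat" where "enc_sequent = code_sequent"
instance
proof (standard, rule bij_encI)
  fix n
  obtain p :: "trm fset \<times> trm" where "n = enc p" by (rule enc_cases)
  then have "enc (fst p \<turnstile> snd p) = n"
    by (simp add: enc_sequent_def enc_prod_def enc_fset_def enc_trm_def)
  then show "\<exists>J :: sequent. enc J = n" ..
next
  fix J K :: sequent
  assume "enc J = enc K"
  then show "J = K" unfolding enc_sequent_def by (rule injD[OF inj_code_sequent])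
qed
end

text \<open>
  The two shapes without arguments take the codes 0 and 1, and the other three share the remaining
  numbers through a sum type, which keeps the coding onto.
\<close>

instantiation head_shape :: coded
begin
primrec enc_head_shape :: "head_shape \<Rightarrow> nat" where
  "enc_head_shape HRec = 0"
| "enc_head_shape HQuant = 1"
| "enc_head_shape (HLam b) = Suc (Suc (enc (Inl b :: trm + (trm + trm \<times> trm))))"
| "enc_head_shape (HRec1 g) = Suc (Suc (enc (Inr (Inl g) :: trm + (trm + trm \<times> trm))))"
| "enc_head_shape (HRec2 g h) = Suc (Suc (enc (Inr (Inr (g, h)) :: trm + (trm + trm \<times> trm))))"
instance
proof (standard, rule bij_encI)
  fix n
  consider "n = 0" | "n = 1" | m where "n = Suc (Suc m)" by (metis One_nat_def not0_implies_Suc)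
  then show "\<exists>w :: head_shape. enc w = n"
  proof cases
    case 3
    obtain s :: "trm + (trm + trm \<times> trm)" where "m = enc s" by (rule enc_cases)
    then show ?thesis
      using 3 by (cases s rule: sum.exhaust; metis enc_head_shape.simps sum.exhaust surj_pair)
  qed (metis enc_head_shape.simps)+
next
  fix v w :: head_shape
  assume "enc v = enc w"
  then show "v = w" by (cases v; cases w) (simp_all add: enc_eq_iff)
qed
end


section \<open>Computable functions\<close>

definition computable :: "('a::coded \<Rightarrow> 'b::coded) \<Rightarrow> bool" where
  "computable f \<longleftrightarrow> (\<exists>c. \<forall>x. computes c [enc x] (enc (f x)))"

text \<open>
  Computability sees a value only through its code. This turns constructors into arithmetic on codes
  without a program of their own.
\<close>

lemma computable_reencode:
  "computable g \<Longrightarrow> (\<And>x. enc (f x) = enc (g x)) \<Longrightarrow> computable f"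
  unfolding computable_def by simp

lemma computable_id: "computable (\<lambda>x. x)"
  unfolding computable_def using computes_Proj0 by blast

lemma computable_const: "computable (\<lambda>_. a)"
proof -
  have "\<exists>c. \<forall>xs. computes c xs n" for n
  proof (induction n)
    case (Suc n)
    then show ?case by (meson computes_Comp1 computes.suc1)
  qed (blast intro: computes.zer)
  then show ?thesis unfolding computable_def by blast
qed

lemma computable_unaryI:
  assumes "\<And>x. computes c [enc x] (enc (h x))" and "computable f"
  shows "computable (\<lambda>x. h (f x))"
proof -
  obtain cf where "\<And>x. computes cf [enc x] (enc (f x))"
    using assms(2) unfolding computable_def by blast
  then have "computes (Comp c [cf]) [enc x] (enc (h (f x)))" for x
    using assms(1) by (blast intro: computes_Comp1)
  then show ?thesis unfolding computable_def by blast
qed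

lemma computable_binaryI:
  assumes "\<And>x y. computes c [enc x, enc y] (enc (h x y))" and "computable f" and "computable g"
  shows "computable (\<lambda>x. h (f x) (g x))"
proof -
  obtain cf cg where "\<And>x. computes cf [enc x] (enc (f x))" "\<And>x. computes cg [enc x] (enc (g x))"
    using assms(2,3) unfolding computable_def by blast
  then have "computes (Comp c [cf, cg]) [enc x] (enc (h (f x) (g x)))" for x
    using assms(1) by (blast intro: computes_Comp2)
  then show ?thesis unfolding computable_def by blast
qed

lemma computable_comp: "computable h \<Longrightarrow> computable f \<Longrightarrow> computable (\<lambda>x. h (f x))"
  unfolding computable_def[of h] by (blast intro: computable_unaryI)

lemma computable_enc: "computable f \<Longrightarrow> computable (\<lambda>x. enc (f x))"
  by (erule computable_reencode) (simp add: enc_nat_def)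

lemma computable_Suc: "computable f \<Longrightarrow> computable (\<lambda>x. Suc (f x))"
  by (rule computable_unaryI[where h = Suc]) (auto simp: enc_nat_def intro: computes.suc1)

lemma computable_add: "computable f \<Longrightarrow> computable g \<Longrightarrow> computable (\<lambda>x. f x + g x :: nat)"
  by (rule computable_binaryI[where h = "(+)"]) (auto simp: enc_nat_def intro: computes_add)

lemma computable_diff: "computable f \<Longrightarrow> computable g \<Longrightarrow> computable (\<lambda>x. f x - g x :: nat)"
proof (rule computable_binaryI[where h = "(-)"])
  show "computes (Comp sub_code [Proj 1, Proj 0]) [enc m, enc n] (enc (m - n))" for m n :: nat
    unfolding enc_nat_def by (rule computes_intros computes_sub)+
qed

lemma computable_Pair: "computable f \<Longrightarrow> computable g \<Longrightarrow> computable (\<lambda>x. (f x, g x))"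
  by (rule computable_binaryI[where h = Pair]) (auto simp: enc_prod_def intro: computes_pair)

lemma computable_fst: "computable f \<Longrightarrow> computable (\<lambda>x. fst (f x))"
  by (rule computable_unaryI[where h = fst]) (auto simp: enc_prod_def intro: computes_fst)

lemma computable_snd: "computable f \<Longrightarrow> computable (\<lambda>x. snd (f x))"
  by (rule computable_unaryI[where h = snd]) (auto simp: enc_prod_def intro: computes_snd)

lemmas computable_basic_intros = computable_const computable_id computable_Suc computable_add
  computable_diff computable_Pair computable_fst computable_snd computable_enc

text \<open>
  The functions \<open>g\<close> and \<open>h\<close> may depend on the argument \<open>x\<close>, which stays a parameter of the primitive
  recursion; this is the form in which recursors meet the closure rules below.
\<close>

lemma computable_rec_nat:
  assumes n: "computable n" and g: "computable g"
    and h: "computable (\<lambda>z. h (fst z) (fst (snd z)) (snd (snd z)))"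
  shows "computable (\<lambda>x. rec_nat (g x) (h x) (n x))"
proof -
  obtain cg where cg: "\<And>x. computes cg [enc x] (enc (g x))"
    using g unfolding computable_def by blast
  obtain ch where "\<And>z. computes ch [enc z] (enc (h (fst z) (fst (snd z)) (snd (snd z))))"
    using h unfolding computable_def by blast
  then have ch: "computes ch [prod_encode (enc x, prod_encode (k, enc y))] (enc (h x k y))" for x k y
    by (metis enc_nat_def enc_prod_def fst_conv snd_conv)
  let ?s = "Comp ch [Comp pair_code [Proj 2, Comp pair_code [Proj 0, Proj 1]]]"
  have "computes (PrimRec cg ?s) [k, enc x] (enc (rec_nat (g x) (h x) k))" for k x
  proof (induction k)
    case 0
    show ?case by (simp add: computes.primrec_0 cg)
  next
    case (Suc k)
    have "computes ?s [k, enc (rec_nat (g x) (h x) k), enc x] (enc (rec_nat (g x) (h x) (Suc k)))"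
      unfolding nat.rec by (rule computes_intros computes_pair ch)+
    then show ?case by (rule computes.primrec_Suc[OF Suc])
  qed
  then show ?thesis
    by (intro computable_binaryI[where h = "\<lambda>k x. rec_nat (g x) (h x) k" and f = n and g = "\<lambda>x. x"
          and c = "PrimRec cg ?s"])
       (simp_all only: enc_nat_def n computable_id)
qed

lemma computable_mult:
  assumes "computable f" and "computable g"
  shows "computable (\<lambda>x. f x * g x :: nat)"
proof -
  have "rec_nat 0 (\<lambda>_ y. y + n) m = m * n" for m n :: nat
    by (induction m) auto
  moreover have "computable (\<lambda>x. rec_nat 0 (\<lambda>_ y. y + g x) (f x))"
    by (intro computable_rec_nat computable_basic_intros assms computable_comp[OF assms(2)])
  ultimately show ?thesis by simp
qed

lemma computable_sum:
  fixes h :: "'a::coded \<Rightarrow> nat \<Rightarrow> nat"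
  assumes "computable b" and "computable (\<lambda>z. h (fst z) (snd z))"
  shows "computable (\<lambda>x. \<Sum>i<b x. h x i)"
proof -
  have "rec_nat 0 (\<lambda>i y. y + k i) n = (\<Sum>i<n. k i)" for k :: "nat \<Rightarrow> nat" and n
    by (induction n) auto
  moreover have "computable (\<lambda>x. rec_nat 0 (\<lambda>i y. y + h x i) (b x))"
    using computable_comp[OF assms(2), where f = "\<lambda>z. (fst z, fst (snd z))"]
    by (intro computable_rec_nat computable_basic_intros assms) (simp add: computable_basic_intros)
  ultimately show ?thesis by simp
qed

lemma computable_prod:
  fixes h :: "'a::coded \<Rightarrow> nat \<Rightarrow> nat"
  assumes "computable b" and "computable (\<lambda>z. h (fst z) (snd z))"
  shows "computable (\<lambda>x. \<Prod>i<b x. h x i)"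
proof -
  have "rec_nat 1 (\<lambda>i y. y * k i) n = (\<Prod>i<n. k i)" for k :: "nat \<Rightarrow> nat" and n
    by (induction n) auto
  moreover have "computable (\<lambda>x. rec_nat 1 (\<lambda>i y. y * h x i) (b x))"
    using computable_comp[OF assms(2), where f = "\<lambda>z. (fst z, fst (snd z))"]
    by (intro computable_rec_nat computable_mult computable_basic_intros assms)
       (simp add: computable_basic_intros)
  ultimately show ?thesis by simp
qed

lemma computable_Least:
  fixes h :: "'a::coded \<Rightarrow> nat \<Rightarrow> nat"
  assumes "computable (\<lambda>z. h (fst z) (snd z))" and "\<And>x. \<exists>n. h x n = 0"
  shows "computable (\<lambda>x. LEAST n. h x n = 0)"
proof -
  obtain c where "\<And>z. computes c [enc z] (enc (h (fst z) (snd z)))"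
    using assms(1) unfolding computable_def by blast
  then have c: "computes c [prod_encode (enc x, n)] (h x n)" for x n
    by (metis enc_nat_def enc_prod_def fst_conv snd_conv)
  let ?c = "Comp c [Comp pair_code [Proj 1, Proj 0]]"
  have step: "computes ?c [n, enc x] (h x n)" for x n
    by (rule computes_intros computes_pair c)+
  have "computes (Mu ?c) [enc x] (enc (LEAST n. h x n = 0))" for x
    unfolding enc_nat_def
  proof (rule computes.mu)
    have "h x (LEAST n. h x n = 0) = 0" using assms(2) by (rule LeastI_ex)
    then show "computes ?c [LEAST n. h x n = 0, enc x] 0"
      using step[of "LEAST n. h x n = 0" x] by simp
    show "\<forall>i<(LEAST n. h x n = 0). \<exists>y. computes ?c [i, enc x] (Suc y)"
    \<comment> \<open>The unqualified name would denote the quantifier rule of the calculus.\<close>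
    proof (intro HOL.allI impI)
      fix i
      assume "i < (LEAST n. h x n = 0)"
      then have "h x i = Suc (h x i - 1)" using not_less_Least by fastforce
      then show "\<exists>y. computes ?c [i, enc x] (Suc y)" using step[of i x] by metis
    qed
  qed
  then show ?thesis unfolding computable_def by blast
qed


section \<open>Semidecidable predicates\<close>

text \<open>
  The second component of the argument of \<open>f\<close> is a witness. Zero stands for acceptance, so that
  conjunction, disjunction and the bounded quantifiers become sums and products.
\<close>

definition semidec :: "('a::coded \<Rightarrow> bool) \<Rightarrow> bool" where
  "semidec P \<longleftrightarrow> (\<exists>f :: 'a \<times> nat \<Rightarrow> nat. computable f \<and> (\<forall>x. P x \<longleftrightarrow> (\<exists>n. f (x, n) = 0)))"

definition dec :: "nat \<Rightarrow> 'a::coded" where "dec = inv enc"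

lemma enc_dec: "enc (dec n) = n"
  unfolding dec_def by (rule surj_f_inv_f[OF bij_is_surj[OF bij_enc]])

lemma dec_enc: "dec (enc x) = x"
  unfolding dec_def by (rule inv_f_f[OF bij_is_inj[OF bij_enc]])

lemma ex_dec: "(\<exists>n. P (dec n)) \<longleftrightarrow> (\<exists>y. P y)"
  by (metis dec_enc)

lemma computable_dec: "computable f \<Longrightarrow> computable (\<lambda>x. dec (f x))"
  by (erule computable_reencode) (simp add: enc_dec enc_nat_def)

text \<open>
  Witnesses may be taken from any coded type, in particular pairs of witnesses.
\<close>

lemma semidecI:
  assumes "computable f" and "\<And>x. P x \<longleftrightarrow> (\<exists>w. f (x, w :: 'b::coded) = (0::nat))"
  shows "semidec P"
proof -
  have "computable (\<lambda>z. f (fst z, dec (snd z)))"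
    by (intro computable_comp[OF assms(1)] computable_basic_intros computable_dec)
  moreover have "P x \<longleftrightarrow> (\<exists>n. f (x, dec n) = 0)" for x
    unfolding assms(2) by (rule ex_dec[symmetric])
  ultimately show ?thesis unfolding semidec_def by fastforce
qed

lemma semidecE:
  assumes "semidec P"
  obtains f :: "'a::coded \<times> nat \<Rightarrow> nat"
    where "computable f" and "\<And>x. P x \<longleftrightarrow> (\<exists>n. f (x, n) = 0)"
  using assms unfolding semidec_def by metis

lemma semidec_comp: "semidec P \<Longrightarrow> computable g \<Longrightarrow> semidec (\<lambda>x. P (g x))"
proof (erule semidecE)
  fix f :: "'a \<times> nat \<Rightarrow> nat"
  assume f: "computable f" "\<And>x. P x \<longleftrightarrow> (\<exists>n. f (x, n) = 0)" and g: "computable g"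
  show "semidec (\<lambda>x. P (g x))"
    by (rule semidecI[where f = "\<lambda>z. f (g (fst z), snd z)"])
       (auto simp: f(2) intro!: computable_basic_intros computable_comp[OF f(1)] computable_comp[OF g])
qed

text \<open>
  The sum of the two truncated differences of two codes vanishes iff the codes agree.
\<close>

lemma semidec_eq:
  assumes "computable f" and "computable g"
  shows "semidec (\<lambda>x. f x = g x)"
proof (rule semidecI)
  show "computable (\<lambda>z :: 'a \<times> nat.
      (enc (f (fst z)) - enc (g (fst z))) + (enc (g (fst z)) - enc (f (fst z))))"
    by (intro computable_basic_intros computable_comp[OF assms(1)] computable_comp[OF assms(2)])
  show "f x = g x \<longleftrightarrow> (\<exists>w :: nat. enc (f (fst (x, w))) - enc (g (fst (x, w))) +
      (enc (g (fst (x, w))) - enc (f (fst (x, w)))) = 0)" for x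
    unfolding enc_eq_iff[of "f x" "g x", symmetric] by auto
qed

lemma semidec_conj:
  fixes P Q :: "'a::coded \<Rightarrow> bool"
  assumes "semidec P" and "semidec Q"
  shows "semidec (\<lambda>x. P x \<and> Q x)"
proof -
  obtain f :: "'a \<times> nat \<Rightarrow> nat" where f: "computable f" "\<And>x. P x \<longleftrightarrow> (\<exists>n. f (x, n) = 0)"
    using assms(1) unfolding semidec_def by metis
  obtain g :: "'a \<times> nat \<Rightarrow> nat" where g: "computable g" "\<And>x. Q x \<longleftrightarrow> (\<exists>n. g (x, n) = 0)"
    using assms(2) unfolding semidec_def by metis
  show ?thesis
  proof (rule semidecI)
    show "computable (\<lambda>z. f (fst z, fst (snd z)) + g (fst z, snd (snd z)))"
      by (intro computable_basic_intros computable_comp[OF f(1)] computable_comp[OF g(1)])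
  qed (simp add: f(2) g(2))
qed

lemma semidec_disj:
  fixes P Q :: "'a::coded \<Rightarrow> bool"
  assumes "semidec P" and "semidec Q"
  shows "semidec (\<lambda>x. P x \<or> Q x)"
proof -
  obtain f :: "'a \<times> nat \<Rightarrow> nat" where f: "computable f" "\<And>x. P x \<longleftrightarrow> (\<exists>n. f (x, n) = 0)"
    using assms(1) unfolding semidec_def by metis
  obtain g :: "'a \<times> nat \<Rightarrow> nat" where g: "computable g" "\<And>x. Q x \<longleftrightarrow> (\<exists>n. g (x, n) = 0)"
    using assms(2) unfolding semidec_def by metis
  show ?thesis
  proof (rule semidecI)
    show "computable (\<lambda>z. f z * g z)"
      by (intro computable_mult f(1) g(1))
  qed (auto simp add: f(2) g(2))
qed

lemma semidec_ex:
  fixes P :: "'a::coded \<Rightarrow> 'b::coded \<Rightarrow> bool"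
  assumes "semidec (\<lambda>z. P (fst z) (snd z))"
  shows "semidec (\<lambda>x. \<exists>y. P x y)"
proof -
  obtain f :: "('a \<times> 'b) \<times> nat \<Rightarrow> nat" where f: "computable f" "\<And>z. P (fst z) (snd z) \<longleftrightarrow> (\<exists>n. f (z, n) = 0)"
    using assms unfolding semidec_def by metis
  show ?thesis
  proof (rule semidecI)
    show "computable (\<lambda>z. f ((fst z, fst (snd z)), snd (snd z)))"
      by (intro computable_basic_intros computable_comp[OF f(1)])
    show "(\<exists>y. P x y) \<longleftrightarrow> (\<exists>w. f ((fst (x, w), fst (snd (x, w))), snd (snd (x, w))) = 0)" for x
      using f(2)[of "(x, _)"] by simp
  qed
qed

text \<open>
  Finitely many witnesses have a common strict bound \<open>m\<close>, so the single number \<open>m\<close> can witness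
  the whole conjunction: a sum over \<open>i\<close> of products over \<open>n < m\<close> vanishes iff each \<open>i\<close> has a
  witness below \<open>m\<close>.
\<close>

lemma semidec_all_less:
  fixes P :: "'a::coded \<Rightarrow> nat \<Rightarrow> bool"
  assumes "computable b" and "semidec (\<lambda>z. P (fst z) (snd z))"
  shows "semidec (\<lambda>x. \<forall>i<b x. P x i)"
proof -
  obtain f :: "('a \<times> nat) \<times> nat \<Rightarrow> nat" where f: "computable f" "\<And>z. P (fst z) (snd z) \<longleftrightarrow> (\<exists>n. f (z, n) = 0)"
    using assms(2) unfolding semidec_def by metis
  show ?thesis
  proof (rule semidecI)
    show "computable (\<lambda>z. \<Sum>i<b (fst z). \<Prod>n<snd z. f ((fst z, i), n))"
      by (intro computable_sum computable_prod computable_basic_intros computable_comp[OF f(1)]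
          computable_comp[OF assms(1)])
    fix x
    have "(\<forall>i<b x. P x i) \<longleftrightarrow> (\<forall>i<b x. \<exists>n. f ((x, i), n) = 0)"
      using f(2)[of "(x, _)"] by simp
    also have "\<dots> \<longleftrightarrow> (\<exists>m. \<forall>i<b x. \<exists>n<m. f ((x, i), n) = 0)"
    proof
      assume "\<forall>i<b x. \<exists>n. f ((x, i), n) = 0"
      then obtain n where n: "\<forall>i<b x. f ((x, i), n i) = 0" by metis
      have "\<forall>i<b x. n i < Suc (Max (n ` {..<b x}))" by (simp add: less_Suc_eq_le)
      with n show "\<exists>m. \<forall>i<b x. \<exists>n<m. f ((x, i), n) = 0" by blast
    qed blast
    finally show "(\<forall>i<b x. P x i) \<longleftrightarrow>
        (\<exists>m. (\<Sum>i<b (fst (x, m)). \<Prod>n<snd (x, m). f ((fst (x, m), i), n)) = 0)"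
      by (simp add: Ball_def Bex_def)
  qed
qed

text \<open>
  To compute \<open>f x\<close>, search for a pair of a value and a witness that this value belongs to \<open>x\<close>. The
  search stops because \<open>f\<close> is total, and it stops at the right value because the graph is that of a
  function.
\<close>

lemma computable_if_semidec_graph:
  fixes f :: "'a::coded \<Rightarrow> 'b::coded"
  assumes "semidec (\<lambda>z. f (fst z) = snd z)"
  shows "computable f"
proof -
  obtain w :: "('a \<times> 'b) \<times> nat \<Rightarrow> nat" where w: "computable w" "\<And>z. f (fst z) = snd z \<longleftrightarrow> (\<exists>n. w (z, n) = 0)"
    using assms unfolding semidec_def by metis
  let ?h = "\<lambda>x k. w ((x, fst (dec k :: 'b \<times> nat)), snd (dec k :: 'b \<times> nat))"
  have sound: "f x = fst (dec k :: 'b \<times> nat)" if "?h x k = 0" for x k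
    using w(2)[of "(x, fst (dec k :: 'b \<times> nat))"] that by auto
  have ex: "\<exists>k. ?h x k = 0" for x
  proof -
    obtain n where "w ((x, f x), n) = 0" using w(2)[of "(x, f x)"] by auto
    then show ?thesis by (intro exI[of _ "enc (f x, n)"]) (simp add: dec_enc)
  qed
  have "f x = fst (dec (LEAST k. ?h x k = 0) :: 'b \<times> nat)" for x
    by (rule sound) (rule LeastI_ex[OF ex])
  then have f: "f = (\<lambda>x. fst (dec (LEAST k. ?h x k = 0) :: 'b \<times> nat))" by (rule ext)
  show ?thesis
    unfolding f
    by (intro computable_fst computable_dec computable_Least computable_comp[OF w(1)]
        computable_basic_intros ex)
qed

lemma recursively_enumerable_if_semidec:
  fixes P :: "'a::coded \<Rightarrow> bool"
  assumes "semidec P"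
  shows "recursively_enumerable {enc x | x. P x}"
proof -
  obtain f :: "'a \<times> nat \<Rightarrow> nat" where f: "computable f" "\<And>x. P x \<longleftrightarrow> (\<exists>n. f (x, n) = 0)"
    using assms unfolding semidec_def by metis
  obtain c where "\<And>z. computes c [enc z] (enc (f z))"
    using f(1) unfolding computable_def by blast
  then have c: "computes c [prod_encode (enc x, n)] (f (x, n))" for x n
    by (metis enc_nat_def enc_prod_def fst_conv snd_conv)
  let ?c = "Comp c [Comp pair_code [Proj 1, Proj 0]]"
  have step: "computes ?c [n, enc x] (f (x, n))" for x n
    by (rule computes_intros computes_pair c)+
  have "P x \<longleftrightarrow> (\<exists>y. computes (Mu ?c) [enc x] y)" for x
  proof
    assume "P x"
    let ?n = "LEAST n. f (x, n) = 0"
    have "f (x, ?n) = 0" using \<open>P x\<close> f(2) by (auto intro: LeastI)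
    then have "computes ?c [?n, enc x] 0" using step[of ?n x] by simp
    moreover have "\<forall>i<?n. \<exists>y. computes ?c [i, enc x] (Suc y)"
    proof (intro HOL.allI impI)
      fix i
      assume "i < ?n"
      then have "f (x, i) = Suc (f (x, i) - 1)" using not_less_Least by fastforce
      then show "\<exists>y. computes ?c [i, enc x] (Suc y)" using step[of i x] by metis
    qed
    ultimately have "computes (Mu ?c) [enc x] ?n" by (rule computes.mu)
    then show "\<exists>y. computes (Mu ?c) [enc x] y" ..
  next
    assume "\<exists>y. computes (Mu ?c) [enc x] y"
    then obtain y where "computes ?c [y, enc x] 0" by (auto elim: computes_MuE)
    then have "f (x, y) = 0" using step by (rule computes_functional[symmetric])
    then show "P x" using f(2) by blast
  qed
  then have "{enc x | x. P x} = {n. \<exists>y. computes (Mu ?c) [n] y}"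
    using enc_cases by (metis (lifting))
  then show ?thesis unfolding recursively_enumerable_def by blast
qed


section \<open>Computability of constructors and of list operations\<close>

lemma computable_Inl: "computable f \<Longrightarrow> computable (\<lambda>x. Inl (f x) :: 'a::coded + 'b::coded)"
  by (rule computable_reencode[of "\<lambda>x. enc (f x) + enc (f x)"])
     (auto simp: enc_sum_def enc_nat_def sum_encode_def intro!: computable_basic_intros)

lemma computable_Inr: "computable f \<Longrightarrow> computable (\<lambda>x. Inr (f x) :: 'b::coded + 'a::coded)"
  by (rule computable_reencode[of "\<lambda>x. Suc (enc (f x) + enc (f x))"])
     (auto simp: enc_sum_def enc_nat_def sum_encode_def intro!: computable_basic_intros)

lemma computable_Cons:
  "computable f \<Longrightarrow> computable g \<Longrightarrow> computable (\<lambda>x. f x # g x)"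
  by (rule computable_reencode[of "\<lambda>x. Suc (enc (f x, g x))"], intro computable_basic_intros)
     (simp_all add: enc_list_def enc_nat_def enc_prod_def)

lemma computable_Var: "computable f \<Longrightarrow> computable (\<lambda>x. Var (f x))"
  by (rule computable_reencode[of "\<lambda>x. Inl (f x) :: nat + nat"])
     (auto simp: enc_trm_def enc_sum_def enc_nat_def intro!: computable_Inl)

lemma enc_Op: "enc (Op f k ts) = enc (Inr (f, k, ts) :: nat + nat \<times> nat \<times> trm list)"
  by (simp add: enc_trm_def enc_sum_def enc_prod_def enc_list_def enc_nat_def cong: map_cong)

lemma computable_Op:
  "computable f \<Longrightarrow> computable k \<Longrightarrow> computable ts \<Longrightarrow> computable (\<lambda>x. Op (f x) (k x) (ts x))"
  by (rule computable_reencode[OF _ enc_Op])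
     (intro computable_Inr computable_basic_intros)

lemma computable_Sequent:
  "computable f \<Longrightarrow> computable g \<Longrightarrow> computable (\<lambda>x. f x \<turnstile> g x)"
  by (rule computable_reencode[of "\<lambda>x. (f x, g x)"])
     (auto simp: enc_sequent_def enc_prod_def enc_trm_def enc_fset_def intro!: computable_basic_intros)

lemma computable_HLam: "computable f \<Longrightarrow> computable (\<lambda>x. HLam (f x))"
  by (rule computable_reencode[of "\<lambda>x. Suc (Suc (enc (Inl (f x) :: trm + (trm + trm \<times> trm))))"])
     (auto simp: enc_nat_def intro!: computable_basic_intros computable_Inl)

lemma computable_HRec1: "computable f \<Longrightarrow> computable (\<lambda>x. HRec1 (f x))"
  by (rule computable_reencode[of "\<lambda>x. Suc (Suc (enc (Inr (Inl (f x)) :: trm + (trm + trm \<times> trm))))"])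
     (auto simp: enc_nat_def intro!: computable_basic_intros computable_Inl computable_Inr)

lemma computable_HRec2:
  "computable f \<Longrightarrow> computable g \<Longrightarrow> computable (\<lambda>x. HRec2 (f x) (g x))"
  by (rule computable_reencode[of
        "\<lambda>x. Suc (Suc (enc (Inr (Inr (f x, g x)) :: trm + (trm + trm \<times> trm))))"])
     (auto simp: enc_nat_def intro!: computable_basic_intros computable_Inr)

lemmas computable_intros = computable_basic_intros computable_Inl computable_Inr computable_Cons
  computable_Var computable_Op computable_Sequent computable_HLam computable_HRec1 computable_HRec2

lemmas semidec_intros = semidec_conj semidec_disj semidec_ex semidec_eq

text \<open>
  Destructors come for free from constructors: the graph of a destructor is an existentially
  quantified equation between constructor terms.
\<close>

lemma computable_tl: "computable (\<lambda>xs :: 'a::coded list. tl xs)"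
proof (rule computable_if_semidec_graph)
  have "tl xs = ys \<longleftrightarrow> xs = [] \<and> ys = [] \<or> (\<exists>x. xs = x # ys)" for xs ys :: "'a list"
    by (cases xs) auto
  then show "semidec (\<lambda>z :: 'a list \<times> 'a list. tl (fst z) = snd z)"
    by (simp only:) (intro semidec_intros computable_intros)
qed

lemma drop_eq_rec_nat: "drop n xs = rec_nat xs (\<lambda>_. tl) n"
proof (induction n)
  case (Suc n)
  have "drop (Suc n) xs = tl (drop n xs)" by (simp add: drop_Suc tl_drop)
  then show ?case by (simp only: Suc nat.rec)
qed simp

lemma computable_drop:
  "computable n \<Longrightarrow> computable xs \<Longrightarrow> computable (\<lambda>x. drop (n x) (xs x))"
  unfolding drop_eq_rec_nat
  by (intro computable_rec_nat computable_comp[OF computable_tl] computable_intros)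

lemma computable_length:
  fixes xs :: "'a::coded \<Rightarrow> 'c::coded list"
  assumes "computable xs"
  shows "computable (\<lambda>x. length (xs x))"
proof -
  have "computable (\<lambda>xs :: 'c list. LEAST n. enc (drop n xs) = 0)"
  proof (rule computable_Least)
    show "computable (\<lambda>z :: 'c list \<times> nat. enc (drop (snd z) (fst z)))"
      by (intro computable_drop computable_intros)
    show "\<exists>n. enc (drop n xs) = 0" for xs :: "'c list"
      by (rule exI[of _ "length xs"]) (simp add: enc_list_def)
  qed
  moreover have "(LEAST n. enc (drop n xs) = 0) = length xs" for xs :: "'c list"
  proof (rule Least_equality)
    show "enc (drop (length xs) xs) = 0" by (simp add: enc_list_def)
    show "length xs \<le> n" if "enc (drop n xs) = 0" for n
      using that by (cases "drop n xs") (auto simp: enc_list_def)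
  qed
  ultimately have "computable (\<lambda>xs :: 'c list. length xs)" by simp
  from computable_comp[OF this assms] show ?thesis .
qed

text \<open>
  The function \<open>(!)\<close> is unspecified beyond the length of the list. Quantifying over the tails of a
  list avoids it.
\<close>

lemma in_set_iff_drop: "y \<in> set xs \<longleftrightarrow> (\<exists>i ys. drop i xs = y # ys)"
proof
  assume "y \<in> set xs"
  then show "\<exists>i ys. drop i xs = y # ys" by (metis in_set_conv_nth Cons_nth_drop_Suc)
next
  assume "\<exists>i ys. drop i xs = y # ys"
  then show "y \<in> set xs" by (metis in_set_dropD list.set_intros(1))
qed

lemma semidec_in_set:
  assumes "computable f" and "computable g"
  shows "semidec (\<lambda>x. f x \<in> set (g x))"
  unfolding in_set_iff_drop
  by (intro semidec_intros computable_drop computable_intros computable_comp[OF assms(1)]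
      computable_comp[OF assms(2)])

lemma semidec_ball_set:
  assumes "computable f" and "semidec (\<lambda>z. P (fst z) (snd z))"
  shows "semidec (\<lambda>x. \<forall>y\<in>set (f x). P x y)"
proof -
  have "(\<forall>y\<in>set xs. P x y) \<longleftrightarrow> (\<forall>i<length xs. \<exists>y ys. drop i xs = y # ys \<and> P x y)" for x xs
    unfolding all_set_conv_all_nth using Cons_nth_drop_Suc by (metis list.inject)
  then show ?thesis
    by (simp only:) (intro semidec_all_less semidec_intros computable_length computable_drop
      computable_intros assms(1) computable_comp[OF assms(1)]
      semidec_comp[OF assms(2), where g = "\<lambda>z. (fst (fst (fst z)), snd (fst z))", simplified])
qed


section \<open>Inductive definitions with semidecidable rules\<close>

text \<open>
  A rule system is given as a relation \<open>W\<close> between a conclusion and the list of its premises. Lists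
  are finite, so derivations are finite too, and their codes can be searched.
\<close>

inductive generated :: "('a \<Rightarrow> 'a list \<Rightarrow> bool) \<Rightarrow> 'a \<Rightarrow> bool" for W where
  "W x D \<Longrightarrow> (\<And>y. y \<in> set D \<Longrightarrow> generated W y) \<Longrightarrow> generated W x"

text \<open>
  Derivations are written with the latest conclusion first, so the premises of an entry are found in
  the tail after it.
\<close>

primrec derivation :: "('a \<Rightarrow> 'a list \<Rightarrow> bool) \<Rightarrow> 'a list \<Rightarrow> bool" where
  "derivation W [] \<longleftrightarrow> True"
| "derivation W (x # xs) \<longleftrightarrow> (\<exists>D. W x D \<and> set D \<subseteq> set xs) \<and> derivation W xs"

lemma derivation_append: "derivation W xs \<Longrightarrow> derivation W ys \<Longrightarrow> derivation W (xs @ ys)"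
  by (induction xs) auto

lemma generated_if_in_derivation: "derivation W xs \<Longrightarrow> x \<in> set xs \<Longrightarrow> generated W x"
  by (induction xs arbitrary: x) (auto intro: generated.intros)

text \<open>
  Derivations of the premises can simply be concatenated, because a derivation stays one when it is
  put in front of another.
\<close>

lemma derivation_if_generated: "generated W x \<Longrightarrow> \<exists>xs. derivation W xs \<and> x \<in> set xs"
proof (induction rule: generated.induct)
  case (1 x D)
  have "\<exists>xs. derivation W xs \<and> set D' \<subseteq> set xs" if "set D' \<subseteq> set D" for D'
    using that
  proof (induction D')
    case (Cons y D')
    then obtain xs where "derivation W xs" "set D' \<subseteq> set xs" by auto
    moreover obtain ys where "derivation W ys" "y \<in> set ys" using Cons.prems 1(3)[of y] by auto
    ultimately show ?case by (intro exI[of _ "ys @ xs"]) (auto intro: derivation_append)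
  qed (auto intro: exI[of _ "[]"])
  then obtain xs where "derivation W xs" "set D \<subseteq> set xs" by blast
  with 1(1) show ?case by (intro exI[of _ "x # xs"]) auto
qed

lemma derivation_iff_drop:
  "derivation W xs \<longleftrightarrow>
     (\<forall>i<length xs. \<exists>x ys D. drop i xs = x # ys \<and> W x D \<and> (\<forall>y\<in>set D. y \<in> set ys))"
  by (induction xs) (auto simp: All_less_Suc2)

text \<open>
  The search is for a derivation; being one is a bounded universal statement about its tails.
\<close>

lemma semidec_generated:
  assumes "semidec (\<lambda>z. W (fst z) (snd z))"
  shows "semidec (\<lambda>x. generated W x)"
proof -
  have "generated W x \<longleftrightarrow> (\<exists>xs. derivation W xs \<and> x \<in> set xs)" for x
    by (blast intro: generated_if_in_derivation dest: derivation_if_generated)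
  moreover have "semidec (\<lambda>x. \<exists>xs. derivation W xs \<and> x \<in> set xs)"
    unfolding derivation_iff_drop
    by (intro semidec_all_less semidec_ball_set semidec_in_set semidec_intros computable_length
        computable_drop computable_intros
        semidec_comp[OF assms, where g = "\<lambda>z. (snd (fst (fst z)), snd z)", simplified])
  ultimately show ?thesis by simp
qed



lemma generated_axiom: "W x [] \<Longrightarrow> generated W x"
  by (erule generated.intros) simp

lemma generated_step: "W x [y] \<Longrightarrow> generated W y \<Longrightarrow> generated W x"
  by (erule generated.intros) simp

lemma generated_step2:
  "W x [y, z] \<Longrightarrow> generated W y \<Longrightarrow> generated W z \<Longrightarrow> generated W x"
  by (erule generated.intros) auto

lemma generated_step3:
  "W x [y, z, w] \<Longrightarrow> generated W y \<Longrightarrow> generated W z \<Longrightarrow> generated W w \<Longrightarrow> generated W x"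
  by (erule generated.intros) auto

text \<open>
  It is enough that every generated pair is correct and that every argument occurs in some
  generated pair; correctness then shows that this pair carries the right value.
\<close>

lemma computable_if_generated:
  fixes f :: "'a::coded \<Rightarrow> 'b::coded"
  assumes semidec: "semidec (\<lambda>z. W (fst z) (snd z))"
    and sound: "\<And>x y D. W (x, y) D \<Longrightarrow> \<forall>z\<in>set D. snd z = f (fst z) \<Longrightarrow> y = f x"
    and total: "\<And>x. \<exists>y. generated W (x, y)"
  shows "computable f"
proof (rule computable_if_semidec_graph)
  have "snd z = f (fst z)" if "generated W z" for z
    using that
  proof induction
    case (1 z D)
    then show ?case using sound[of "fst z" "snd z" D] by simp
  qed
  then have "f (fst z) = snd z \<longleftrightarrow> generated W z" for z
    using total[of "fst z"] by (metis fst_conv snd_conv prod.collapse)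
  then show "semidec (\<lambda>z. f (fst z) = snd z)"
    using semidec_generated[OF semidec] by simp
qed


section \<open>Finite sets\<close>

lemma set_decode_double: "set_decode (n + n) = Suc ` set_decode n"
proof -
  have "i \<in> set_decode (n + n) \<longleftrightarrow> i \<in> Suc ` set_decode n" for i
    by (cases i) (auto simp flip: mult_2)
  then show ?thesis by blast
qed

lemma set_decode_Suc_double: "set_decode (Suc (n + n)) = insert 0 (Suc ` set_decode n)"
proof -
  have "i \<in> set_decode (Suc (n + n)) \<longleftrightarrow> i \<in> insert 0 (Suc ` set_decode n)" for i
    by (cases i) (auto simp flip: mult_2)
  then show ?thesis by blast
qed

text \<open>
  Inserting \<open>i\<close> into a finite set means setting bit \<open>i\<close> of its code. The rules walk down the binary
  digits: bit 0 is set directly, and any other bit is set in the half of the code.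
\<close>

inductive insert_rule :: "(nat \<times> nat) \<times> nat \<Rightarrow> ((nat \<times> nat) \<times> nat) list \<Rightarrow> bool" where
  "insert_rule ((0, n + n), Suc (n + n)) []"
| "insert_rule ((0, Suc (n + n)), Suc (n + n)) []"
| "insert_rule ((Suc i, n + n), m + m) [((i, n), m)]"
| "insert_rule ((Suc i, Suc (n + n)), Suc (m + m)) [((i, n), m)]"

lemma insert_rule_sound:
  assumes "insert_rule ((i, n), m) D"
    and "\<forall>z\<in>set D. set_decode (snd z) = insert (fst (fst z)) (set_decode (snd (fst z)))"
  shows "set_decode m = insert i (set_decode n)"
  using assms by cases (auto simp: set_decode_double set_decode_Suc_double)

lemma insert_rule_total: "\<exists>m. generated insert_rule ((i, n), m)"
proof (induction i arbitrary: n)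
  case 0
  obtain k where "n = k + k \<or> n = Suc (k + k)"
    by (metis evenE oddE mult_2 Suc_eq_plus1)
  then show ?case
    by (elim HOL.disjE) (blast intro: generated_axiom insert_rule.intros)+
next
  case (Suc i)
  obtain k where "n = k + k \<or> n = Suc (k + k)"
    by (metis evenE oddE mult_2 Suc_eq_plus1)
  moreover obtain m where "generated insert_rule ((i, k), m)" using Suc by blast
  ultimately show ?case
    by (elim HOL.disjE) (blast intro: generated_step insert_rule.intros)+
qed

lemma computable_insert_code: "computable (\<lambda>(i, n). set_encode (insert i (set_decode n)))"
proof (rule computable_if_generated)
  show "semidec (\<lambda>z. insert_rule (fst z) (snd z))"
    unfolding insert_rule.simps by (intro semidec_intros computable_intros)
  show "\<exists>m. generated insert_rule (x, m)" for x
    using insert_rule_total by (cases x) auto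
  have "set_decode m = A \<longleftrightarrow> m = set_encode A" if "finite A" for m A
    using that by (metis set_decode_inverse set_encode_inverse)
  then show "m = (case x of (i, n) \<Rightarrow> set_encode (insert i (set_decode n)))"
    if "insert_rule (x, m) D"
      "\<forall>z\<in>set D. snd z = (case fst z of (i, n) \<Rightarrow> set_encode (insert i (set_decode n)))" for x m D
    using that insert_rule_sound[of "fst x" "snd x" m D] by (auto simp: split_beta)
qed

lemma computable_finsert:
  assumes "computable f" and "computable A"
  shows "computable (\<lambda>x. finsert (f x) (A x))"
proof (rule computable_reencode)
  show "computable (\<lambda>x. (\<lambda>(i, n). set_encode (insert i (set_decode n))) (enc (f x), enc (A x)))"
    by (intro computable_comp[OF computable_insert_code] computable_intros assms)
qed (simp add: enc_fset_def enc_nat_def)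

text \<open>
  Finite sets are processed by inserting one element at a time, in any order and possibly with
  repetitions; this needs no canonical listing of a set.
\<close>

inductive fimage_rule ::
  "('p \<Rightarrow> 'a \<Rightarrow> 'b) \<Rightarrow> ('p \<times> 'a fset) \<times> 'b fset \<Rightarrow> (('p \<times> 'a fset) \<times> 'b fset) list \<Rightarrow> bool"
  for g where
  "fimage_rule g ((p, {||}), {||}) []"
| "fimage_rule g ((p, finsert a A), finsert (g p a) B) [((p, A), B)]"

lemma computable_fimage:
  fixes g :: "'p::coded \<Rightarrow> 'a::coded \<Rightarrow> 'b::coded"
  assumes g: "computable (\<lambda>z. g (fst z) (snd z))" and A: "computable A"
  shows "computable (\<lambda>x. g x |`| A x)"
proof -
  have "computable (\<lambda>(p, A). g p |`| A)"
  proof (rule computable_if_generated)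
    have g': "computable (\<lambda>x. g (u x) (v x))" if "computable u" "computable v"
      for u :: "'c::coded \<Rightarrow> 'p" and v
      using computable_comp[OF g computable_Pair[OF that]] by simp
    show "semidec (\<lambda>z. fimage_rule g (fst z) (snd z))"
      unfolding fimage_rule.simps
      by (intro semidec_intros g' computable_intros computable_finsert)
    show "B = (case x of (p, A) \<Rightarrow> g p |`| A)"
      if "fimage_rule g (x, B) D" "\<forall>z\<in>set D. snd z = (case fst z of (p, A) \<Rightarrow> g p |`| A)" for x B D
      using that by cases auto
    show "\<exists>B. generated (fimage_rule g) (x, B)" for x
    proof -
      have "\<exists>B. generated (fimage_rule g) ((p, A), B)" for p A
      proof (induction A)
        case empty
        show ?case by (blast intro: generated_axiom fimage_rule.intros)
      next
        case (insert a A)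
        then obtain B where "generated (fimage_rule g) ((p, A), B)" by blast
        then show ?case
          by (blast intro: generated_step fimage_rule.intros)
      qed
      then show ?thesis by (cases x) auto
    qed
  qed
  from computable_comp[OF this computable_Pair[OF computable_id A]] show ?thesis by simp
qed

inductive fBall_rule :: "('p \<Rightarrow> 'a \<Rightarrow> bool) \<Rightarrow> 'p \<times> 'a fset \<Rightarrow> ('p \<times> 'a fset) list \<Rightarrow> bool"
  for P where
  "fBall_rule P (p, {||}) []"
| "P p a \<Longrightarrow> fBall_rule P (p, finsert a A) [(p, A)]"

lemma generated_fBall_rule: "generated (fBall_rule P) (p, A) \<longleftrightarrow> fBall A (P p)"
proof
  assume "generated (fBall_rule P) (p, A)"
  then show "fBall A (P p)"
    by (induction "(p, A)" arbitrary: p A) (auto elim: fBall_rule.cases)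
next
  show "fBall A (P p) \<Longrightarrow> generated (fBall_rule P) (p, A)"
  proof (induction A)
    case empty
    show ?case by (blast intro: generated_axiom fBall_rule.intros)
  next
    case (insert a A)
    then show ?case by (blast intro: generated_step fBall_rule.intros)
  qed
qed

lemma semidec_fBall:
  assumes P: "semidec (\<lambda>z. P (fst z) (snd z))" and A: "computable A"
  shows "semidec (\<lambda>x. fBall (A x) (P x))"
proof -
  have P': "semidec (\<lambda>x. P (u x) (v x))" if "computable u" "computable v"
    for u :: "'c::coded \<Rightarrow> 'a" and v :: "'c \<Rightarrow> 'b"
    using semidec_comp[OF P computable_Pair[OF that]] by simp
  have "semidec (\<lambda>z. fBall_rule P (fst z) (snd z))"
    unfolding fBall_rule.simps
    by (intro semidec_intros P' computable_intros computable_finsert)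
  from semidec_comp[OF semidec_generated[OF this] computable_Pair[OF computable_id A]]
  show ?thesis by (simp add: generated_fBall_rule)
qed


section \<open>Syntactic operations on terms\<close>

text \<open>
  The recursion through the argument list of a node is expressed by comparing the node with the one
  that lacks its first argument. Thus a single relation on terms suffices, without a companion
  relation on lists of terms. Comparisons of indices become patterns: \<open>i < c\<close> is \<open>c = Suc (i + j)\<close>.
\<close>

inductive shift_rule ::
  "(nat \<times> nat \<times> trm) \<times> trm \<Rightarrow> ((nat \<times> nat \<times> trm) \<times> trm) list \<Rightarrow> bool" where
  "shift_rule ((d, Suc (i + j), Var i), Var i) []"
| "shift_rule ((d, c, Var (c + j)), Var (c + j + d)) []"
| "shift_rule ((d, c, Op f k []), Op f k []) []"
| "shift_rule ((d, c, Op f k (t # ts)), Op f k (t' # ts'))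
     [((d, c + k, t), t'), ((d, c, Op f k ts), Op f k ts')]"

lemma shift_rule_total: "\<exists>t'. generated shift_rule ((d, c, t), t')"
proof (induction t arbitrary: c)
  case (Var i)
  show ?case
  proof (cases "i < c")
    case True
    then obtain j where "c = Suc (i + j)" by (auto dest: less_imp_Suc_add)
    then show ?thesis
      by (elim ssubst) (blast intro: generated_axiom shift_rule.intros)
  next
    case False
    then obtain j where "i = c + j" by (metis le_Suc_ex not_less)
    then show ?thesis
      by (elim ssubst) (blast intro: generated_axiom shift_rule.intros)
  qed
next
  case (Op f k ts)
  then have "\<exists>ts'. generated shift_rule ((d, c, Op f k ts), Op f k ts')"
  proof (induction ts)
    case Nil
    show ?case by (blast intro: generated_axiom shift_rule.intros)
  next
    case (Cons t ts)
    obtain t' where t': "generated shift_rule ((d, c + k, t), t')"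
      using Cons.prems[of t] by auto
    obtain ts' where ts': "generated shift_rule ((d, c, Op f k ts), Op f k ts')"
      using Cons by auto
    have "generated shift_rule ((d, c, Op f k (t # ts)), Op f k (t' # ts'))"
      by (rule generated_step2[OF _ t' ts']) (rule shift_rule.intros(4))
    then show ?case by blast
  qed
  then show ?case by blast
qed

lemma computable_shift:
  assumes "computable d" and "computable c" and "computable t"
  shows "computable (\<lambda>x. shift (d x) (c x) (t x))"
proof -
  have "computable (\<lambda>(d, c, t). shift d c t)"
  proof (rule computable_if_generated)
    show "semidec (\<lambda>z. shift_rule (fst z) (snd z))"
      unfolding shift_rule.simps by (intro semidec_intros computable_intros)
    show "t' = (case x of (d, c, t) \<Rightarrow> shift d c t)"
      if "shift_rule (x, t') D" "\<forall>z\<in>set D. snd z = (case fst z of (d, c, t) \<Rightarrow> shift d c t)"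
      for x t' D
      using that by cases auto
    show "\<exists>t'. generated shift_rule (x, t')" for x
      using shift_rule_total by (cases x) auto
  qed
  from computable_comp[OF this computable_Pair[OF assms(1) computable_Pair[OF assms(2,3)]]]
  show ?thesis by simp
qed

inductive subst_rule ::
  "(nat \<times> trm \<times> trm) \<times> trm \<Rightarrow> ((nat \<times> trm \<times> trm) \<times> trm) list \<Rightarrow> bool" where
  "subst_rule ((i, s, Var i), s) []"
| "subst_rule ((i, s, Var (Suc (i + j))), Var (Suc (i + j))) []"
| "subst_rule ((Suc (i + j), s, Var i), Var i) []"
| "subst_rule ((i, s, Op f k []), Op f k []) []"
| "subst_rule ((i, s, Op f k (t # ts)), Op f k (t' # ts'))
     [((i + k, shift k 0 s, t), t'), ((i, s, Op f k ts), Op f k ts')]"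

lemma subst_rule_total: "\<exists>t'. generated subst_rule ((i, s, t), t')"
proof (induction t arbitrary: i s)
  case (Var j)
  consider "i = j" | n where "j = Suc (i + n)" | n where "i = Suc (j + n)"
    by (metis less_imp_Suc_add linorder_neqE_nat)
  then show ?case
    by cases (erule ssubst, blast intro: generated_axiom subst_rule.intros)+
next
  case (Op f k ts)
  then have "\<exists>ts'. generated subst_rule ((i, s, Op f k ts), Op f k ts')"
  proof (induction ts)
    case Nil
    show ?case by (blast intro: generated_axiom subst_rule.intros)
  next
    case (Cons t ts)
    obtain t' where t': "generated subst_rule ((i + k, shift k 0 s, t), t')"
      using Cons.prems[of t] by auto
    obtain ts' where ts': "generated subst_rule ((i, s, Op f k ts), Op f k ts')"
      using Cons by auto
    have "generated subst_rule ((i, s, Op f k (t # ts)), Op f k (t' # ts'))"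
      by (rule generated_step2[OF _ t' ts']) (rule subst_rule.intros(5))
    then show ?case by blast
  qed
  then show ?case by blast
qed

lemma computable_subst:
  assumes "computable i" and "computable s" and "computable t"
  shows "computable (\<lambda>x. subst (i x) (s x) (t x))"
proof -
  have "computable (\<lambda>(i, s, t). subst i s t)"
  proof (rule computable_if_generated)
    show "semidec (\<lambda>z. subst_rule (fst z) (snd z))"
      unfolding subst_rule.simps by (intro semidec_intros computable_shift computable_intros)
    show "t' = (case x of (i, s, t) \<Rightarrow> subst i s t)"
      if "subst_rule (x, t') D" "\<forall>z\<in>set D. snd z = (case fst z of (i, s, t) \<Rightarrow> subst i s t)"
      for x t' D
      using that by cases auto
    show "\<exists>t'. generated subst_rule (x, t')" for x
      using subst_rule_total by (cases x) auto
  qed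
  from computable_comp[OF this computable_Pair[OF assms(1) computable_Pair[OF assms(2,3)]]]
  show ?thesis by simp
qed

inductive inst_rule ::
  "(nat \<times> trm \<times> trm) \<times> trm \<Rightarrow> ((nat \<times> trm \<times> trm) \<times> trm) list \<Rightarrow> bool" where
  "inst_rule ((i, s, Var i), s) []"
| "inst_rule ((i, s, Var (Suc (i + j))), Var (i + j)) []"
| "inst_rule ((Suc (i + j), s, Var i), Var i) []"
| "inst_rule ((i, s, Op f k []), Op f k []) []"
| "inst_rule ((i, s, Op f k (t # ts)), Op f k (t' # ts'))
     [((i + k, shift k 0 s, t), t'), ((i, s, Op f k ts), Op f k ts')]"

lemma inst_rule_total: "\<exists>t'. generated inst_rule ((i, s, t), t')"
proof (induction t arbitrary: i s)
  case (Var j)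
  consider "i = j" | n where "j = Suc (i + n)" | n where "i = Suc (j + n)"
    by (metis less_imp_Suc_add linorder_neqE_nat)
  then show ?case
    by cases (erule ssubst, blast intro: generated_axiom inst_rule.intros)+
next
  case (Op f k ts)
  then have "\<exists>ts'. generated inst_rule ((i, s, Op f k ts), Op f k ts')"
  proof (induction ts)
    case Nil
    show ?case by (blast intro: generated_axiom inst_rule.intros)
  next
    case (Cons t ts)
    obtain t' where t': "generated inst_rule ((i + k, shift k 0 s, t), t')"
      using Cons.prems[of t] by auto
    obtain ts' where ts': "generated inst_rule ((i, s, Op f k ts), Op f k ts')"
      using Cons by auto
    have "generated inst_rule ((i, s, Op f k (t # ts)), Op f k (t' # ts'))"
      by (rule generated_step2[OF _ t' ts']) (rule inst_rule.intros(5))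
    then show ?case by blast
  qed
  then show ?case by blast
qed

lemma computable_inst_at:
  assumes "computable i" and "computable s" and "computable t"
  shows "computable (\<lambda>x. inst_at (i x) (s x) (t x))"
proof -
  have "computable (\<lambda>(i, s, t). inst_at i s t)"
  proof (rule computable_if_generated)
    show "semidec (\<lambda>z. inst_rule (fst z) (snd z))"
      unfolding inst_rule.simps by (intro semidec_intros computable_shift computable_intros)
    show "t' = (case x of (i, s, t) \<Rightarrow> inst_at i s t)"
      if "inst_rule (x, t') D" "\<forall>z\<in>set D. snd z = (case fst z of (i, s, t) \<Rightarrow> inst_at i s t)"
      for x t' D
      using that by cases auto
    show "\<exists>t'. generated inst_rule (x, t')" for x
      using inst_rule_total by (cases x) auto
  qed
  from computable_comp[OF this computable_Pair[OF assms(1) computable_Pair[OF assms(2,3)]]]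
  show ?thesis by simp
qed

lemma natnum_eq_rec_nat: "natnum n = rec_nat Zero (\<lambda>_ t. Sc t) n"
  by (induction n) auto

lemma computable_natnum: "computable n \<Longrightarrow> computable (\<lambda>x. natnum (n x))"
  unfolding natnum_eq_rec_nat by (intro computable_rec_nat computable_intros)

lemmas computable_syntax_intros = computable_intros computable_finsert computable_fimage
  computable_shift computable_subst computable_inst_at computable_natnum

inductive well_formed_rule :: "trm \<Rightarrow> trm list \<Rightarrow> bool" where
  "well_formed_rule (Var i) []"
| "(f, k, length ts) \<in> signature \<Longrightarrow> well_formed_rule (Op f k ts) ts"

lemma generated_well_formed_rule: "generated well_formed_rule t \<longleftrightarrow> well_formed t"
proof
  show "generated well_formed_rule t \<Longrightarrow> well_formed t"
    by (induction rule: generated.induct) (auto elim: well_formed_rule.cases)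
  show "well_formed t \<Longrightarrow> generated well_formed_rule t"
    by (induction t) (auto intro: generated.intros well_formed_rule.intros)
qed

lemma semidec_well_formed: "computable f \<Longrightarrow> semidec (\<lambda>x. well_formed (f x))"
proof (rule semidec_comp)
  have "semidec (\<lambda>z. well_formed_rule (fst z) (snd z))"
    unfolding well_formed_rule.simps signature_def insert_iff empty_iff simp_thms
    by (intro semidec_intros computable_length computable_intros)
  from semidec_generated[OF this] show "semidec well_formed"
    by (simp add: generated_well_formed_rule)
qed

text \<open>
  The eigenvariable condition of induction is a negative statement about an inductively given set.
  As an equation between computable functions it becomes positive.
\<close>

lemma not_in_fv_iff: "i \<notin> fv t \<longleftrightarrow> subst i Zero t = t"
proof (induction t arbitrary: i)
  case (Op f k ts)
  have "map (subst (i + k) Zero) ts = ts \<longleftrightarrow> (\<forall>t\<in>set ts. subst (i + k) Zero t = t)"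
    using map_eq_conv[of "subst (i + k) Zero" ts "\<lambda>t. t"] by simp
  then show ?case using Op by simp
qed simp

lemma semidec_not_in_fv:
  "computable i \<Longrightarrow> computable t \<Longrightarrow> semidec (\<lambda>x. i x \<notin> fv (t x))"
  unfolding not_in_fv_iff by (intro semidec_eq computable_syntax_intros)

inductive head_step_rule :: "trm \<times> trm \<Rightarrow> (trm \<times> trm) list \<Rightarrow> bool" where
  "well_formed t \<Longrightarrow> head_step_rule (Lam b \<cdot> t, inst b t) []"
| "well_formed h \<Longrightarrow> head_step_rule (Rec \<cdot> g \<cdot> h \<cdot> Zero, g) []"
| "well_formed g \<Longrightarrow> head_step_rule (Rec \<cdot> g \<cdot> h \<cdot> Sc (natnum n),
     h \<cdot> natnum n \<cdot> (Rec \<cdot> g \<cdot> h \<cdot> natnum n)) []"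
| "head_step_rule (t \<cdot> u, t' \<cdot> u) [(t, t')]"

lemma generated_head_step_rule: "generated head_step_rule (t, t') \<longleftrightarrow> t \<triangleright> t'"
proof
  have "fst z \<triangleright> snd z" if "generated head_step_rule z" for z
    using that
  proof induction
    case (1 z D)
    from 1(1,3) show ?case by cases (auto intro: head_step.intros simp del: One_nat_def)
  qed
  then show "generated head_step_rule (t, t') \<Longrightarrow> t \<triangleright> t'" by fastforce
  show "t \<triangleright> t' \<Longrightarrow> generated head_step_rule (t, t')"
    by (induction rule: head_step.induct)
       (blast intro: generated_axiom generated_step head_step_rule.intros)+
qed

lemma semidec_head_step:
  assumes "computable t" and "computable t'"
  shows "semidec (\<lambda>x. t x \<triangleright> t' x)"
proof -
  have "semidec (\<lambda>z. head_step_rule (fst z) (snd z))"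
    unfolding head_step_rule.simps
    by (intro semidec_intros semidec_well_formed computable_syntax_intros)
  from semidec_comp[OF semidec_generated[OF this] computable_Pair[OF assms]]
  show ?thesis by (simp add: generated_head_step_rule)
qed

lemmas semidec_syntax_intros = semidec_intros semidec_well_formed semidec_not_in_fv
  semidec_head_step semidec_fBall semidec_in_set


section \<open>Proofs\<close>

text \<open>
  The premises are taken from a finite list, so each of them is a decidable membership. Unfolding
  the inductive definition leaves one existential statement for each rule of the calculus.
\<close>

lemma semidec_follows: "semidec (\<lambda>z. follows (set (fst z)) (snd z))"
  unfolding follows.simps
  by (intro semidec_syntax_intros computable_syntax_intros)

inductive snoc_rule :: "('a list \<times> 'a) \<times> 'a list \<Rightarrow> (('a list \<times> 'a) \<times> 'a list) list \<Rightarrow> bool" where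
  "snoc_rule (([], y), [y]) []"
| "snoc_rule ((x # xs, y), x # zs) [((xs, y), zs)]"

lemma computable_snoc:
  fixes xs :: "'a::coded \<Rightarrow> 'b::coded list"
  assumes "computable xs" and "computable y"
  shows "computable (\<lambda>x. xs x @ [y x])"
proof -
  have "computable (\<lambda>(xs, y :: 'b). xs @ [y])"
  proof (rule computable_if_generated)
    show "semidec (\<lambda>z :: (('b list \<times> 'b) \<times> 'b list) \<times> _. snoc_rule (fst z) (snd z))"
      unfolding snoc_rule.simps by (intro semidec_intros computable_intros)
    show "zs = (case x of (xs, y) \<Rightarrow> xs @ [y])"
      if "snoc_rule (x, zs) D" "\<forall>z\<in>set D. snd z = (case fst z of (xs, y) \<Rightarrow> xs @ [y])"
      for x :: "'b list \<times> 'b" and zs D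
      using that by cases auto
    have "\<exists>zs. generated snoc_rule ((xs, y), zs)" for xs and y :: 'b
      by (induction xs) (blast intro: generated_axiom generated_step snoc_rule.intros)+
    then show "\<exists>zs. generated snoc_rule (x, zs)" for x :: "'b list \<times> 'b" by (cases x) auto
  qed
  from computable_comp[OF this computable_Pair[OF assms]] show ?thesis by simp
qed

text \<open>
  This makes the set of all proofs an inductive definition of its own, with one rule for lengthening
  a proof.
\<close>

lemma is_proof_snoc: "is_proof (P @ [J]) \<longleftrightarrow> is_proof P \<and> follows (set P) J"
  by (auto simp: is_proof_def All_less_Suc nth_append)

inductive is_proof_rule :: "sequent list \<Rightarrow> sequent list list \<Rightarrow> bool" where
  "is_proof_rule [] []"
| "follows (set P) J \<Longrightarrow> is_proof_rule (P @ [J]) [P]"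

lemma generated_is_proof_rule: "generated is_proof_rule P \<longleftrightarrow> is_proof P"
proof
  show "generated is_proof_rule P \<Longrightarrow> is_proof P"
  proof (induction rule: generated.induct)
    case (1 P D)
    from 1(1,3) show ?case by cases (auto simp: is_proof_snoc is_proof_def[of "[]"])
  qed
  show "is_proof P \<Longrightarrow> generated is_proof_rule P"
    by (induction P rule: rev_induct)
       (auto simp: is_proof_snoc intro: generated_axiom generated_step is_proof_rule.intros)
qed

lemma semidec_proves:
  assumes "computable P" and "computable J"
  shows "semidec (\<lambda>x. P x \<rhd> J x)"
proof -
  have follows: "semidec (\<lambda>x. follows (set (Q x)) (K x))" if "computable Q" "computable K"
    for Q :: "'c::coded \<Rightarrow> sequent list" and K
    using semidec_comp[OF semidec_follows computable_Pair[OF that]] by simp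
  have "semidec (\<lambda>z. is_proof_rule (fst z) (snd z))"
    unfolding is_proof_rule.simps
    by (intro semidec_intros follows computable_snoc computable_intros)
  from semidec_comp[OF semidec_generated[OF this] assms(1)]
  show ?thesis
    unfolding proves_def generated_is_proof_rule
    by (intro semidec_conj semidec_in_set assms)
qed


section \<open>Evaluation\<close>

text \<open>
  Value and head evaluation are mutually inductive; their statements are joined into one type so that
  a single rule system generates both.
\<close>

type_synonym eval_atom = "(trm \<times> nat \<times> nat) + (trm \<times> nat \<times> head_shape)"

abbreviation Val :: "trm \<Rightarrow> nat \<Rightarrow> nat \<Rightarrow> eval_atom" where "Val t s r \<equiv> Inl (t, s, r)"
abbreviation Hd :: "trm \<Rightarrow> nat \<Rightarrow> head_shape \<Rightarrow> eval_atom" where "Hd t s w \<equiv> Inr (t, s, w)"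

text \<open>
  These are the clauses of evaluation with the recursive premises collected in a list. The clause for
  equality is split by its outcome, with inequality of the values in the positive form
  \<open>m < n \<or> n < m\<close>. The stage is kept, since it bounds the codes of the proofs that the quantifier
  clauses may use.
\<close>

inductive eval_rule :: "eval_atom \<Rightarrow> eval_atom list \<Rightarrow> bool" where
  "eval_rule (Val Zero (Suc s) 0) []"
| "eval_rule (Val (Sc a) (Suc s) (Suc n)) [Val a s n]"
| "eval_rule (Val (a \<^bold>= b) (Suc s) tt) [Val a s n, Val b s n]"
| "m < n \<or> n < m \<Longrightarrow> eval_rule (Val (a \<^bold>= b) (Suc s) ff) [Val a s m, Val b s n]"
| "eval_rule (Val (\<^bold>\<not> a) (Suc s) tt) [Val a s ff]"
| "eval_rule (Val (\<^bold>\<not> a) (Suc s) ff) [Val a s tt]"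
| "eval_rule (Val (a \<^bold>\<or> b) (Suc s) tt) [Val a s tt]"
| "eval_rule (Val (a \<^bold>\<or> b) (Suc s) tt) [Val b s tt]"
| "eval_rule (Val (a \<^bold>\<or> b) (Suc s) ff) [Val a s ff, Val b s ff]"
| "eval_rule (Val (t \<cdot> u) (Suc s) r) [Hd t s (HLam b), Val (inst b u) s r]"
| "eval_rule (Val (t \<cdot> m) (Suc s) r) [Hd t s (HRec2 g h), Val m s 0, Val g s r]"
| "eval_rule (Val (t \<cdot> m) (Suc s) r) [Hd t s (HRec2 g h), Val m s (Suc k),
     Val (h \<cdot> natnum k \<cdot> (Rec \<cdot> g \<cdot> h \<cdot> natnum k)) s r]"
| "code_proof P \<le> s \<Longrightarrow> P \<rhd> ({|IsNat (Var 0)|} \<turnstile> \<up> u \<cdot> Var 0) \<Longrightarrow>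
     eval_rule (Val (t \<cdot> u) (Suc s) tt) [Hd t s HQuant]"
| "code_proof P \<le> s \<Longrightarrow> P \<rhd> ({||} \<turnstile> \<^bold>\<not> (u \<cdot> natnum i)) \<Longrightarrow>
     eval_rule (Val (t \<cdot> u) (Suc s) ff) [Hd t s HQuant]"
| "eval_rule (Hd (Lam b) (Suc s) (HLam b)) []"
| "eval_rule (Hd Rec (Suc s) HRec) []"
| "eval_rule (Hd Quant (Suc s) HQuant) []"
| "eval_rule (Hd (t \<cdot> g) (Suc s) (HRec1 g)) [Hd t s HRec]"
| "eval_rule (Hd (t \<cdot> h) (Suc s) (HRec2 g h)) [Hd t s (HRec1 g)]"
| "eval_rule (Hd (t \<cdot> u) (Suc s) w) [Hd t s (HLam b), Hd (inst b u) s w]"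
| "eval_rule (Hd (t \<cdot> m) (Suc s) w) [Hd t s (HRec2 g h), Val m s 0, Hd g s w]"
| "eval_rule (Hd (t \<cdot> m) (Suc s) w) [Hd t s (HRec2 g h), Val m s (Suc k),
     Hd (h \<cdot> natnum k \<cdot> (Rec \<cdot> g \<cdot> h \<cdot> natnum k)) s w]"

fun holds :: "eval_atom \<Rightarrow> bool" where
  "holds (Inl (t, s, r)) \<longleftrightarrow> t \<Down>[s] r"
| "holds (Inr (t, s, w)) \<longleftrightarrow> t \<Down>hd[s] w"

lemma holds_if_generated: "generated eval_rule x \<Longrightarrow> holds x"
proof (induction rule: generated.induct)
  case (1 x D)
  have neq: "(a \<^bold>= b) \<Down>[Suc s] ff" if "a \<Down>[s] m" "b \<Down>[s] n" "m < n \<or> n < m" for a b s m n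
    using evaluates_head_evaluates.eq[OF that(1,2)] that(3) by auto
  have eq: "(a \<^bold>= b) \<Down>[Suc s] tt" if "a \<Down>[s] n" "b \<Down>[s] n" for a b s n
    using evaluates_head_evaluates.eq[OF that] by simp
  have "\<forall>y\<in>set D. holds y" using 1(3) by blast
  with 1(1) show ?case
    by cases (simp_all del: One_nat_def,
      ((elim conjE)?, (rule evaluates_head_evaluates.intros eq neq; assumption))+)
qed

lemma generated_if_evaluates:
  "t \<Down>[s] r \<Longrightarrow> generated eval_rule (Val t s r)"
  "t \<Down>hd[s] w \<Longrightarrow> generated eval_rule (Hd t s w)"
proof (induction rule: evaluates_head_evaluates.inducts)
  case (eq a s m b n)
  then show ?case
    by (cases "m = n")
       (auto intro: generated_step2 eval_rule.intros simp del: One_nat_def elim: linorder_neqE_nat)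
qed (blast intro: generated_axiom generated_step generated_step2 generated_step3 eval_rule.intros)+

lemma computable_code_proof: "computable P \<Longrightarrow> computable (\<lambda>x. code_proof (P x))"
  by (erule computable_reencode) (simp add: code_proof_def enc_nat_def enc_list_def enc_sequent_def)

lemma semidec_le: "computable f \<Longrightarrow> computable g \<Longrightarrow> semidec (\<lambda>x. f x \<le> (g x :: nat))"
  unfolding diff_is_0_eq[symmetric] by (intro semidec_eq computable_basic_intros)

lemma semidec_eval_rule: "semidec (\<lambda>z. eval_rule (fst z) (snd z))"
  unfolding eval_rule.simps Suc_le_eq[symmetric]
  by (intro semidec_intros semidec_le semidec_proves computable_code_proof computable_syntax_intros)

lemma semidec_evaluates:
  assumes "computable t" and "computable s" and "computable r"
  shows "semidec (\<lambda>x. t x \<Down>[s x] r x)"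
proof -
  have "t \<Down>[s] r \<longleftrightarrow> generated eval_rule (Val t s r)" for t s r
    using holds_if_generated[of "Val t s r"] generated_if_evaluates(1) by auto
  then show ?thesis
    using semidec_comp[OF semidec_generated[OF semidec_eval_rule], of "\<lambda>x. Val (t x) (s x) (r x)"]
    by (simp add: computable_intros assms)
qed

theorem theorem5p2:
  shows "recursively_enumerable {code_trm c | c. well_formed c \<and> grounded_true c}"
proof -
  have "semidec (\<lambda>c. well_formed c \<and> grounded_true c)"
    unfolding grounded_true_def
    by (intro semidec_intros semidec_well_formed semidec_evaluates computable_intros)
  from recursively_enumerable_if_semidec[OF this] show ?thesis
    by (simp add: enc_trm_def)
qed

end
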